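(* Let $\mathfrak g$ be a graded real Lie algebra as in the context, with basis $\omega_1,\dots,\omega_n$ of $\mathfrak g^{[1]}$. (a) Let $\rho$ be a representation of $\mathfrak g$ in a finite-dimensional complex linear space $W$. Then $\rho$ can be integrated to a representation of the group $\mathbf G^\circ(\mathbb C)$ in $W$. (b) Let (for a Hermitian inner product on $W$) the operators $\rho(\omega_j)$ be anti-selfadjoint. Then the group $\mathbf G^\circ(\mathbb R)$ acts in $W$ by unitary operators.
   Context: $\mathfrak g=\bigoplus_{k>0}\mathfrak g^{[k]}$ is a graded real Lie algebra, $[\mathfrak g^{[k]},\mathfrak g^{[m]}]\subset\mathfrak g^{[k+m]}$, $\dim\mathfrak g^{[k]}<\infty$, generated by $\mathfrak g^{[1]}$; $\omega_1,\dots,\omega_n$ is a fixed basis of $\mathfrak g^{[1]}$; $\mathfrak g_{\mathbb C}$ is its complexification. For $\mathfrak h=\mathfrak g$ or $\mathfrak g_{\mathbb C}$ (ground field $\mathbb K=\mathbb R$ or $\mathbb C$): the universal enveloping algebra $U(\mathfrak h)=\bigoplus_{p\ge0}U(\mathfrak h)^{[p]}$ has the induced grading; $\overline U(\mathfrak h)=\prod_{p\ge 0}U(\mathfrak h)^{[p]}$ is the algebra of formal series $z=\sum_p z^{[p]}$; $\overline{\mathfrak h}=\prod_{k\ge1}\mathfrak h^{[k]}\subset\overline U(\mathfrak h)$. The group $\overline{\mathbf G}(\mathbb K)$ is $\{\exp(x):x\in\overline{\mathfrak h}\}\subset\overline U(\mathfrak h)$ under multiplication. For $z\in U(\mathfrak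 h)^{[p]}$ the norm is $\|z\|=\inf\sum_w|c_w|$, the infimum over all representations $z=\sum_w c_w w$, $c_w\in\mathbb K$, as a finite linear combination of words $w=\omega_{j_1}\cdots\omega_{j_p}$. $U^\circ(\mathfrak h)$ is the set of $z\in\overline U(\mathfrak h)$ such that $\sup_p\|z^{[p]}\|e^{Cp}<\infty$ for every real $C$. The group $\mathbf G^\circ(\mathbb K)$ is $\overline{\mathbf G}(\mathbb K)\cap U^\circ(\mathfrak h)$. The restriction of the representation in (a) to $\mathbf G^\circ(\mathbb R)\subset\mathbf G^\circ(\mathbb C)$ is the action meant in (b). *)

theory Defs
  imports Complex_Main "HOL-Library.Product_Plus" "HOL-Algebra.QuotRing"
begin

section \<open>Graded Lie algebras\<close>

locale lie_algebra = vector_space scale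
  for scale :: "'k::field \<Rightarrow> 'a::ab_group_add \<Rightarrow> 'a" +
  fixes br :: "'a \<Rightarrow> 'a \<Rightarrow> 'a"
  assumes br_add_left: "br (x + y) z = br x z + br y z"
    and br_add_right: "br x (y + z) = br x y + br x z"
    and br_scale_left: "br (scale c x) y = scale c (br x y)"
    and br_scale_right: "br x (scale c y) = scale c (br x y)"
    and br_self: "br x x = 0"
    and jacobi: "br x (br y z) + br y (br z x) + br z (br x y) = 0"

text \<open>
  The grading is indexed by all natural numbers; the component of degree 0 is required to
  vanish, so that the algebra is the direct sum of its components of positive degree.
\<close>

locale graded_lie_algebra = lie_algebra scale br
  for scale :: "'k::field \<Rightarrow> 'a::ab_group_add \<Rightarrow> 'a" and br :: "'a \<Rightarrow> 'a \<Rightarrow> 'a" +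
  fixes gr :: "nat \<Rightarrow> 'a set"
  assumes gr_zero: "gr 0 = {0}"
    and gr_subspace: "subspace (gr k)"
    and gr_finite_dim: "\<exists>B. finite B \<and> span B = gr k"
    and gr_direct_sum: "\<exists>!c. (\<forall>k. c k \<in> gr k) \<and> finite {k. c k \<noteq> 0} \<and> x = (\<Sum>k | c k \<noteq> 0. c k)"
    and gr_bracket: "x \<in> gr k \<Longrightarrow> y \<in> gr m \<Longrightarrow> br x y \<in> gr (k + m)"
    and gr_generated: "subspace S \<Longrightarrow> (\<And>x y. x \<in> S \<Longrightarrow> y \<in> S \<Longrightarrow> br x y \<in> S) \<Longrightarrow> gr 1 \<subseteq> S \<Longrightarrow> S = UNIV"

text \<open>The complexification is realised on pairs, where \<open>(x, y)\<close> stands for \<open>x + \<i> y\<close>.\<close>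

definition cscale :: "complex \<Rightarrow> 'g::real_vector \<times> 'g \<Rightarrow> 'g \<times> 'g" where
  "cscale c x = (Re c *\<^sub>R fst x - Im c *\<^sub>R snd x, Re c *\<^sub>R snd x + Im c *\<^sub>R fst x)"

definition cbr :: "('g::real_vector \<Rightarrow> 'g \<Rightarrow> 'g) \<Rightarrow> 'g \<times> 'g \<Rightarrow> 'g \<times> 'g \<Rightarrow> 'g \<times> 'g" where
  "cbr br x y = (br (fst x) (fst y) - br (snd x) (snd y), br (fst x) (snd y) + br (snd x) (fst y))"

definition cgr :: "(nat \<Rightarrow> 'g set) \<Rightarrow> nat \<Rightarrow> ('g \<times> 'g) set" where
  "cgr gr k = gr k \<times> gr k"


section \<open>The universal enveloping algebra\<close>

text \<open>
  The free associative unital algebra on the set of all elements of a Lie algebra, as finitely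
  supported functions on words. The enveloping algebra is its quotient by the two-sided ideal
  that makes the inclusion of letters linear and turns the bracket into the commutator.
\<close>

definition free_alg :: "('a list \<Rightarrow> 'k::field) ring" where
  "free_alg = \<lparr>carrier = {f. finite {w. f w \<noteq> 0}},
     mult = (\<lambda>f g w. \<Sum>i\<le>length w. f (take i w) * g (drop i w)),
     one = (\<lambda>w. if w = [] then 1 else 0),
     zero = (\<lambda>w. 0),
     add = (\<lambda>f g w. f w + g w)\<rparr>"

definition word_monom :: "'k::field \<Rightarrow> 'a list \<Rightarrow> 'a list \<Rightarrow> 'k" where
  "word_monom c v = (\<lambda>w. if w = v then c else 0)"

context
  fixes scale :: "'k::real_normed_field \<Rightarrow> 'a::ab_group_add \<Rightarrow> 'a"
    and br :: "'a \<Rightarrow> 'a \<Rightarrow> 'a"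
begin

definition uea_ideal :: "('a list \<Rightarrow> 'k) set" where
  "uea_ideal = genideal free_alg
     ({(\<lambda>w. word_monom 1 [x + y] w - word_monom 1 [x] w - word_monom 1 [y] w) | x y. True}
      \<union> {(\<lambda>w. word_monom 1 [scale c x] w - word_monom c [x] w) | c x. True}
      \<union> {(\<lambda>w. word_monom 1 [x, y] w - word_monom 1 [y, x] w - word_monom 1 [br x y] w) | x y. True})"

definition uea :: "('a list \<Rightarrow> 'k) set ring" where
  "uea = free_alg Quot uea_ideal"

definition uea_class :: "('a list \<Rightarrow> 'k) \<Rightarrow> ('a list \<Rightarrow> 'k) set" where
  "uea_class f = a_r_coset free_alg uea_ideal f"

definition uea_scale :: "'k \<Rightarrow> ('a list \<Rightarrow> 'k) set \<Rightarrow> ('a list \<Rightarrow> 'k) set" where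
  "uea_scale c u = uea_class (word_monom c []) \<otimes>\<^bsub>uea\<^esub> u"

end

context
  fixes scale :: "'k::real_normed_field \<Rightarrow> 'a::ab_group_add \<Rightarrow> 'a"
    and br :: "'a \<Rightarrow> 'a \<Rightarrow> 'a"
    and gr :: "nat \<Rightarrow> 'a set"
begin

text \<open>
  The component of degree \<open>p\<close> is spanned by the products \<open>x\<^sub>1 \<cdots> x\<^sub>m\<close> of homogeneous elements
  whose degrees add up to \<open>p\<close>.
\<close>

definition uea_grade :: "nat \<Rightarrow> ('a list \<Rightarrow> 'k) set set" where
  "uea_grade p = {uea_class scale br f | f. f \<in> carrier free_alg \<and>
     (\<forall>w. f w \<noteq> 0 \<longrightarrow> (\<exists>ks. list_all2 (\<lambda>x k. x \<in> gr k) w ks \<and> sum_list ks = p))}"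


section \<open>Formal series and the group of exponentials\<close>

text \<open>A formal series is the sequence of its homogeneous components.\<close>

definition useries :: "(nat \<Rightarrow> ('a list \<Rightarrow> 'k) set) ring" where
  "useries = \<lparr>carrier = {z. \<forall>p. z p \<in> uea_grade p},
     mult = (\<lambda>y z p. \<Oplus>\<^bsub>uea scale br\<^esub>i\<in>{..p}. y i \<otimes>\<^bsub>uea scale br\<^esub> z (p - i)),
     one = (\<lambda>p. if p = 0 then \<one>\<^bsub>uea scale br\<^esub> else \<zero>\<^bsub>uea scale br\<^esub>),
     zero = (\<lambda>p. \<zero>\<^bsub>uea scale br\<^esub>),
     add = (\<lambda>y z p. y p \<oplus>\<^bsub>uea scale br\<^esub> z p)\<rparr>"

text \<open>
  The element of the completed Lie algebra with homogeneous components \<open>\<xi> k\<close>. Since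
  \<open>gr 0 = {0}\<close>, its component of degree 0 is zero.
\<close>

definition lie_series :: "(nat \<Rightarrow> 'a) \<Rightarrow> nat \<Rightarrow> ('a list \<Rightarrow> 'k) set" where
  "lie_series \<xi> = (\<lambda>k. uea_class scale br (word_monom 1 [\<xi> k]))"

definition lie_completion :: "(nat \<Rightarrow> ('a list \<Rightarrow> 'k) set) set" where
  "lie_completion = {lie_series \<xi> | \<xi>. \<forall>k. \<xi> k \<in> gr k}"

text \<open>
  The exponential of a series without term of degree 0: the powers \<open>x\<^sup>m\<close> with \<open>m > p\<close> do not
  contribute to the component of degree \<open>p\<close>.
\<close>

definition useries_exp :: "(nat \<Rightarrow> ('a list \<Rightarrow> 'k) set) \<Rightarrow> nat \<Rightarrow> ('a list \<Rightarrow> 'k) set" where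
  "useries_exp x = (\<lambda>p. \<Oplus>\<^bsub>uea scale br\<^esub>m\<in>{..p}.
     uea_scale scale br (1 / fact m) ((x [^]\<^bsub>useries\<^esub> m) p))"

definition G_bar :: "(nat \<Rightarrow> ('a list \<Rightarrow> 'k) set) set" where
  "G_bar = useries_exp ` lie_completion"

context
  fixes \<Omega> :: "'a set"
begin

text \<open>
  \<open>\<Omega>\<close> is the set of the basis vectors \<open>\<omega>\<^sub>1, \<dots>, \<omega>\<^sub>n\<close>. A finite linear combination of words of
  length \<open>p\<close> in these letters is a finitely supported coefficient function \<open>c\<close>, and the
  element it represents is the class of \<open>c\<close>.
\<close>

definition unorm :: "nat \<Rightarrow> ('a list \<Rightarrow> 'k) set \<Rightarrow> real" where
  "unorm p u = Inf {\<Sum>w | c w \<noteq> 0. norm (c w) | c. c \<in> carrier free_alg \<and>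
     (\<forall>w. c w \<noteq> 0 \<longrightarrow> length w = p \<and> set w \<subseteq> \<Omega>) \<and> u = uea_class scale br c}"

definition U_circ :: "(nat \<Rightarrow> ('a list \<Rightarrow> 'k) set) set" where
  "U_circ = {z \<in> carrier useries.
     \<forall>C::real. bdd_above (range (\<lambda>p. unorm p (z p) * exp (C * real p)))}"

definition G_circ :: "(nat \<Rightarrow> ('a list \<Rightarrow> 'k) set) ring" where
  "G_circ = useries\<lparr>carrier := G_bar \<inter> U_circ\<rparr>"

end

end


section \<open>From real to complex scalars\<close>

definition free_complexify :: "('g::real_vector list \<Rightarrow> real) \<Rightarrow> ('g \<times> 'g) list \<Rightarrow> complex" where
  "free_complexify f w = (if \<forall>x\<in>set w. snd x = 0 then of_real (f (map fst w)) else 0)"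

text \<open>
  The map induced by \<open>free_complexify\<close> from the enveloping algebra of a real Lie algebra to that
  of its complexification, applied to each component of a series. All representatives of a class
  are sent into one and the same class, so the union is that class.
\<close>

definition series_complexify ::
  "('g::real_vector \<Rightarrow> 'g \<Rightarrow> 'g) \<Rightarrow> (nat \<Rightarrow> ('g list \<Rightarrow> real) set) \<Rightarrow> nat \<Rightarrow> (('g \<times> 'g) list \<Rightarrow> complex) set"
  where "series_complexify br z p = (\<Union>f\<in>z p. uea_class cscale (cbr br) (free_complexify f))"


section \<open>Representations in a complex vector space\<close>

definition lie_rep ::
  "(complex \<Rightarrow> 'w::ab_group_add \<Rightarrow> 'w) \<Rightarrow> ('g::real_vector \<Rightarrow> 'g \<Rightarrow> 'g) \<Rightarrow> ('g \<Rightarrow> 'w \<Rightarrow> 'w) \<Rightarrow> bool" where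
  "lie_rep sW br \<rho> \<longleftrightarrow>
     (\<forall>x. Vector_Spaces.linear sW sW (\<rho> x)) \<and>
     (\<forall>x y v. \<rho> (x + y) v = \<rho> x v + \<rho> y v) \<and>
     (\<forall>r x v. \<rho> (r *\<^sub>R x) v = sW (of_real r) (\<rho> x v)) \<and>
     (\<forall>x y v. \<rho> (br x y) v = \<rho> x (\<rho> y v) - \<rho> y (\<rho> x v))"

definition complexify_rep ::
  "(complex \<Rightarrow> 'w::ab_group_add \<Rightarrow> 'w) \<Rightarrow> ('g \<Rightarrow> 'w \<Rightarrow> 'w) \<Rightarrow> 'g \<times> 'g \<Rightarrow> 'w \<Rightarrow> 'w" where
  "complexify_rep sW \<rho> x v = \<rho> (fst x) v + sW \<i> (\<rho> (snd x) v)"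

definition GL :: "(complex \<Rightarrow> 'w::ab_group_add \<Rightarrow> 'w) \<Rightarrow> ('w \<Rightarrow> 'w) monoid" where
  "GL sW = \<lparr>carrier = {T. Vector_Spaces.linear sW sW T \<and> bij T}, mult = (\<circ>), one = id\<rparr>"

text \<open>
  Convergence of a series in the unique Hausdorff vector space topology of a finite-dimensional
  complex space, expressed without choosing a basis or a norm.
\<close>

definition fd_sums ::
  "(complex \<Rightarrow> 'w::ab_group_add \<Rightarrow> 'w) \<Rightarrow> (nat \<Rightarrow> 'w) \<Rightarrow> 'w \<Rightarrow> bool" where
  "fd_sums sW a s \<longleftrightarrow> (\<forall>\<phi>. Vector_Spaces.linear sW (*) \<phi> \<longrightarrow> (\<lambda>k. \<phi> (a k)) sums \<phi> s)"

definition free_eval ::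
  "(complex \<Rightarrow> 'w::ab_group_add \<Rightarrow> 'w) \<Rightarrow> ('a \<Rightarrow> 'w \<Rightarrow> 'w) \<Rightarrow> ('a list \<Rightarrow> complex) \<Rightarrow> 'w \<Rightarrow> 'w" where
  "free_eval sW \<sigma> f v = (\<Sum>w | f w \<noteq> 0. sW (f w) (foldr \<sigma> w v))"

text \<open>
  \<open>R\<close> integrates \<open>\<rho>\<close> if \<open>R (exp x) = exp (\<rho> x)\<close> for every \<open>x\<close> in the complexified Lie algebra,
  written as the finite sum of its homogeneous components \<open>\<xi> k\<close>. Elements of the group need not
  be products of such exponentials; the second condition therefore says that \<open>R\<close> acts by the
  extension of \<open>\<rho>\<close> to the enveloping algebra, \<open>R z = (\<Sum>p. \<rho> (z p))\<close>, where \<open>\<rho> (z p)\<close> is computed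
  on any representative \<open>f p\<close> of \<open>z p\<close>.
\<close>

definition integrates ::
  "(complex \<Rightarrow> 'w::ab_group_add \<Rightarrow> 'w) \<Rightarrow> ('g::real_vector \<Rightarrow> 'g \<Rightarrow> 'g) \<Rightarrow> (nat \<Rightarrow> 'g set) \<Rightarrow> ('g \<times> 'g) set \<Rightarrow>
   ('g \<Rightarrow> 'w \<Rightarrow> 'w) \<Rightarrow> ((nat \<Rightarrow> (('g \<times> 'g) list \<Rightarrow> complex) set) \<Rightarrow> 'w \<Rightarrow> 'w) \<Rightarrow> bool" where
  "integrates sW br gr \<Omega> \<rho> R \<longleftrightarrow>
     (\<forall>\<xi> v. (\<forall>k. \<xi> k \<in> cgr gr k) \<and> finite {k. \<xi> k \<noteq> 0} \<longrightarrow>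
        fd_sums sW
          (\<lambda>m. sW (1 / fact m) (((complexify_rep sW \<rho> (\<Sum>k | \<xi> k \<noteq> 0. \<xi> k)) ^^ m) v))
          (R (useries_exp cscale (cbr br) (cgr gr) (lie_series cscale (cbr br) \<xi>)) v)) \<and>
     (\<forall>z \<in> carrier (G_circ cscale (cbr br) (cgr gr) \<Omega>). \<forall>f v. (\<forall>p. f p \<in> z p) \<longrightarrow>
        fd_sums sW (\<lambda>p. free_eval sW (complexify_rep sW \<rho>) (f p) v) (R z v))"

definition hermitian_inner ::
  "(complex \<Rightarrow> 'w::ab_group_add \<Rightarrow> 'w) \<Rightarrow> ('w \<Rightarrow> 'w \<Rightarrow> complex) \<Rightarrow> bool" where
  "hermitian_inner sW h \<longleftrightarrow>
     (\<forall>u v w. h (u + v) w = h u w + h v w) \<and>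
     (\<forall>c u v. h (sW c u) v = c * h u v) \<and>
     (\<forall>u v. h v u = cnj (h u v)) \<and>
     (\<forall>v. v \<noteq> 0 \<longrightarrow> Re (h v v) > 0)"

definition anti_selfadjoint :: "('w \<Rightarrow> 'w \<Rightarrow> complex) \<Rightarrow> ('w \<Rightarrow> 'w) \<Rightarrow> bool" where
  "anti_selfadjoint h T \<longleftrightarrow> (\<forall>u v. h (T u) v = - h u (T v))"

definition unitary_op ::
  "(complex \<Rightarrow> 'w::ab_group_add \<Rightarrow> 'w) \<Rightarrow> ('w \<Rightarrow> 'w \<Rightarrow> complex) \<Rightarrow> ('w \<Rightarrow> 'w) \<Rightarrow> bool" where
  "unitary_op sW h T \<longleftrightarrow>
     Vector_Spaces.linear sW sW T \<and> bij T \<and> (\<forall>u v. h (T u) (T v) = h u v)"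

end

(*
  For z in the complex group put R z = (\<Sum>p. \<rho> (z p)). Since z p is a combination of words of
  length p in the generators whose coefficients add up to about the norm of z p, and these norms
  decay faster than every exponential, the series converges absolutely; Cauchy products then give
  R (y z) = R y R z.

  The group inverse is produced by the antipode S of the enveloping algebra, x \<mapsto> - x on letters
  and order-reversing on words. It preserves the norm, so (\<Sum>p. \<rho> (S (z p))) converges as well.
  For z = exp x the series S z is exp (- x): sorting the products of components of exp x by
  compositions of the degree reduces S z z = z S z = 1 to the binomial theorem.

  If the generators act by anti-selfadjoint operators, the adjoint of \<rho> (z p) is \<rho> (S (z p)) for
  real z, so the adjoint of R z is its inverse.
*)
theory Submission
  imports Defs "HOL-Analysis.Infinite_Sum"
begin

section \<open>The free algebra and its antipode\<close>

text \<open>Membership of exp x in the group gives decay of the components of exp x but says nothing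
  directly about those of x, so R z is not built by exponentiating a limit operator: it is computed
  on z itself. For the same reason the inverse cannot come from estimating exp (- x) through x;
  reversing the words of a given representation is what carries the bound over. Bijectivity of R z
  then only needs convergence of the reversed series, not that the inverse lies in the group. Two
  obstacles shape the algebra. Components are cosets, so each recipe on words must be shown to
  respect the relations of the enveloping algebra. And the norm is an infimum over words in the
  generators, which is informative only if such a representation exists; generation in degree 1
  provides it, by an induction over homogeneous elements. For a finite sum x, the series exp (rho x)
  and the series of the components of exp x are two groupings of one absolutely summable family of
  words, by length and by degree.\<close>

definition lin_comb :: "'i set \<Rightarrow> ('i \<Rightarrow> 'k::field) \<Rightarrow> ('i \<Rightarrow> 'a list) \<Rightarrow> 'a list \<Rightarrow> 'k" where
  "lin_comb I a u = (\<lambda>w. \<Sum>i\<in>I. word_monom (a i) (u i) w)"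

abbreviation conv :: "('a list \<Rightarrow> 'k::field) \<Rightarrow> ('a list \<Rightarrow> 'k) \<Rightarrow> 'a list \<Rightarrow> 'k" where
  "conv f g \<equiv> f \<otimes>\<^bsub>free_alg\<^esub> g"

lemma free_alg_carrier: "f \<in> carrier free_alg \<longleftrightarrow> finite {w. f w \<noteq> 0}"
  by (simp add: free_alg_def)

lemma free_alg_mult: "conv f g = (\<lambda>w. \<Sum>i\<le>length w. f (take i w) * g (drop i w))"
  by (simp add: free_alg_def)

lemma free_alg_add: "f \<oplus>\<^bsub>free_alg\<^esub> g = (\<lambda>w. f w + g w)"
  by (simp add: free_alg_def)

lemma free_alg_zero: "\<zero>\<^bsub>free_alg\<^esub> = (\<lambda>w. 0)"
  by (simp add: free_alg_def)

lemma free_alg_one: "\<one>\<^bsub>free_alg\<^esub> = word_monom 1 []"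
  by (simp add: free_alg_def word_monom_def)

lemma lin_comb_nonzero: "{w. lin_comb I a u w \<noteq> 0} \<subseteq> u ` I"
  by (force simp: lin_comb_def word_monom_def elim!: sum.not_neutral_contains_not_neutral split: if_splits)

lemma lin_comb_carrier: "finite I \<Longrightarrow> lin_comb I a u \<in> carrier free_alg"
  unfolding free_alg_carrier by (rule finite_subset[OF lin_comb_nonzero]) simp

lemma lin_comb_self:
  assumes "f \<in> carrier free_alg"
  shows "f = lin_comb {w. f w \<noteq> 0} f id"
  using assms by (auto simp: lin_comb_def word_monom_def free_alg_carrier fun_eq_iff)

lemma word_monom_lin_comb: "word_monom c v = lin_comb {()} (\<lambda>_. c) (\<lambda>_. v)"
  by (simp add: lin_comb_def)

lemma word_monom_carrier: "word_monom c v \<in> carrier free_alg"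
  unfolding word_monom_lin_comb by (rule lin_comb_carrier) simp

text \<open>Of all ways to cut \<open>w\<close> in two, only the cut after \<open>length u\<close>
  letters can contribute.\<close>

lemma conv_word_monom: "conv (word_monom c u) (word_monom d v) = word_monom (c * d) (u @ v)"
proof
  fix w
  have "conv (word_monom c u) (word_monom d v) w =
      (\<Sum>i\<le>length w. if i = length u then (if w = u @ v then c * d else 0) else 0)"
    unfolding free_alg_mult
  proof (rule sum.cong[OF refl])
    fix i assume i: "i \<in> {..length w}"
    show "word_monom c u (take i w) * word_monom d v (drop i w) =
        (if i = length u then (if w = u @ v then c * d else 0) else 0)"
    proof (cases "i = length u")
      case True
      hence "w = u @ v \<longleftrightarrow> take i w = u \<and> drop i w = v"
        by (metis append_eq_conv_conj)
      thus ?thesis using True by (simp add: word_monom_def)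
    next
      case False
      hence "take i w \<noteq> u" using i by auto
      thus ?thesis using False by (simp add: word_monom_def)
    qed
  qed
  also have "\<dots> = word_monom (c * d) (u @ v) w"
    by (auto simp: word_monom_def)
  finally show "conv (word_monom c u) (word_monom d v) w = word_monom (c * d) (u @ v) w" .
qed

lemma conv_sum_left: "conv (\<lambda>w. \<Sum>i\<in>I. F i w) g = (\<lambda>w. \<Sum>i\<in>I. conv (F i) g w)"
  unfolding free_alg_mult by (simp add: sum_distrib_right sum.swap[of _ I])

lemma conv_sum_right: "conv g (\<lambda>w. \<Sum>i\<in>I. F i w) = (\<lambda>w. \<Sum>i\<in>I. conv g (F i) w)"
  unfolding free_alg_mult by (simp add: sum_distrib_left sum.swap[of _ I])

text \<open>Equal words are not collected in a \<open>lin_comb\<close>, so a product is indexed by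
  pairs. The ring laws and the reversal by the antipode then become bijections between index
  sets.\<close>

lemma conv_lin_comb:
  "conv (lin_comb I a u) (lin_comb J b v) = lin_comb (I \<times> J) (\<lambda>(i, j). a i * b j) (\<lambda>(i, j). u i @ v j)"
  by (simp add: lin_comb_def conv_sum_left conv_sum_right conv_word_monom sum.cartesian_product
      case_prod_unfold)

lemma lin_comb_reindex:
  assumes "bij_betw h J I" "\<And>j. j \<in> J \<Longrightarrow> a (h j) = b j" "\<And>j. j \<in> J \<Longrightarrow> u (h j) = v j"
  shows "lin_comb I a u = lin_comb J b v"
  by (simp add: lin_comb_def sum.reindex_bij_betw[OF assms(1), symmetric] assms(2,3))

lemma conv_closed:
  assumes "f \<in> carrier free_alg" "g \<in> carrier free_alg"
  shows "conv f g \<in> carrier free_alg"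
proof -
  have "conv f g = conv (lin_comb {w. f w \<noteq> 0} f id) (lin_comb {w. g w \<noteq> 0} g id)"
    using lin_comb_self[OF assms(1)] lin_comb_self[OF assms(2)] by simp
  also have "\<dots> \<in> carrier free_alg"
    unfolding conv_lin_comb using assms by (intro lin_comb_carrier) (simp add: free_alg_carrier)
  finally show ?thesis .
qed

lemma conv_assoc:
  assumes "f \<in> carrier free_alg" "g \<in> carrier free_alg" "h \<in> carrier free_alg"
  shows "conv (conv f g) h = conv f (conv g h)"
proof -
  let ?F = "lin_comb {w. f w \<noteq> 0} f id" and ?G = "lin_comb {w. g w \<noteq> 0} g id" and ?H = "lin_comb {w. h w \<noteq> 0} h id"
  have "conv (conv ?F ?G) ?H = conv ?F (conv ?G ?H)"
    unfolding conv_lin_comb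
    by (rule lin_comb_reindex[where h = "\<lambda>(i, j, k). ((i, j), k)"])
      (auto intro!: bij_betwI[where g = "\<lambda>((i, j), k). (i, j, k)"] simp: mult.assoc)
  thus ?thesis 
    by (simp only: lin_comb_self[OF assms(1), symmetric] lin_comb_self[OF assms(2), symmetric]
        lin_comb_self[OF assms(3), symmetric])
qed

lemma conv_one_left:
  assumes "f \<in> carrier free_alg"
  shows "conv (word_monom 1 []) f = f"
proof -
  let ?F = "lin_comb {w. f w \<noteq> 0} f id"
  have "conv (word_monom 1 []) ?F = ?F"
    unfolding word_monom_lin_comb conv_lin_comb
    by (rule lin_comb_reindex[where h = "\<lambda>w. ((), w)"])
      (auto intro!: bij_betwI[where g = snd])
  thus ?thesis by (simp only: lin_comb_self[OF assms, symmetric])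
qed

lemma conv_one_right:
  assumes "f \<in> carrier free_alg"
  shows "conv f (word_monom 1 []) = f"
proof -
  let ?F = "lin_comb {w. f w \<noteq> 0} f id"
  have "conv ?F (word_monom 1 []) = ?F"
    unfolding word_monom_lin_comb conv_lin_comb
    by (rule lin_comb_reindex[where h = "\<lambda>w. (w, ())"])
      (auto intro!: bij_betwI[where g = fst])
  thus ?thesis by (simp only: lin_comb_self[OF assms, symmetric])
qed

lemma free_alg_add_closed:
  assumes "f \<in> carrier free_alg" "g \<in> carrier free_alg"
  shows "(\<lambda>w. f w + g w) \<in> carrier free_alg"
  using assms unfolding free_alg_carrier
  by (auto intro: finite_subset[where B = "{w. f w \<noteq> 0} \<union> {w. g w \<noteq> 0}"])

lemma free_alg_uminus_closed:
  assumes "f \<in> carrier free_alg"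
  shows "(\<lambda>w. - f w) \<in> carrier free_alg"
  using assms unfolding free_alg_carrier by simp

lemma free_alg_diff_closed:
  assumes "f \<in> carrier free_alg" "g \<in> carrier free_alg"
  shows "(\<lambda>w. f w - g w) \<in> carrier free_alg"
  using free_alg_add_closed[OF assms(1) free_alg_uminus_closed[OF assms(2)]] by simp

lemma ring_free_alg: "ring (free_alg :: ('a list \<Rightarrow> 'k::field) ring)"
proof (rule ringI)
  show "abelian_group (free_alg :: ('a list \<Rightarrow> 'k) ring)"
  proof (rule abelian_groupI)
    fix f :: "'a list \<Rightarrow> 'k" assume f: "f \<in> carrier free_alg"
    show "\<exists>g\<in>carrier free_alg. g \<oplus>\<^bsub>free_alg\<^esub> f = \<zero>\<^bsub>free_alg\<^esub>"
      using free_alg_uminus_closed[OF f]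
      by (intro bexI[of _ "\<lambda>w. - f w"]) (auto simp: free_alg_add free_alg_zero)
  qed (auto simp: free_alg_add free_alg_zero free_alg_add_closed add_ac, simp add: free_alg_carrier)
  show "Group.monoid (free_alg :: ('a list \<Rightarrow> 'k) ring)"
    by (rule Group.monoidI)
      (auto simp: free_alg_one conv_closed conv_assoc conv_one_left conv_one_right word_monom_carrier)
qed (auto simp: free_alg_mult free_alg_add sum.distrib algebra_simps)

definition antipode :: "('a list \<Rightarrow> 'k::field) \<Rightarrow> 'a list \<Rightarrow> 'k" where
  "antipode f w = (- 1) ^ length w * f (rev w)"

lemma antipode_lin_comb: "antipode (lin_comb I a u) = lin_comb I (\<lambda>i. (- 1) ^ length (u i) * a i) (\<lambda>i. rev (u i))"
  unfolding antipode_def lin_comb_def word_monom_def sum_distrib_left fun_eq_iff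
  by (intro allI sum.cong[OF refl]) (auto simp: rev_swap)

lemma antipode_word_monom: "antipode (word_monom c u) = word_monom ((- 1) ^ length u * c) (rev u)"
  by (auto simp: antipode_def word_monom_def fun_eq_iff)

lemma antipode_closed:
  assumes "f \<in> carrier free_alg"
  shows "antipode f \<in> carrier free_alg"
proof -
  have "{w. antipode f w \<noteq> 0} \<subseteq> rev ` {w. f w \<noteq> 0}"
    by (metis (mono_tags, lifting) antipode_def image_eqI mem_Collect_eq mult_zero_right rev_rev_ident subsetI)
  thus ?thesis using assms unfolding free_alg_carrier by (blast intro: finite_subset)
qed

lemma antipode_conv:
  assumes "f \<in> carrier free_alg" "g \<in> carrier free_alg"
  shows "antipode (conv f g) = conv (antipode g) (antipode f)"
proof -
  let ?F = "lin_comb {w. f w \<noteq> 0} f id" and ?G = "lin_comb {w. g w \<noteq> 0} g id"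
  have "antipode (conv ?F ?G) = conv (antipode ?G) (antipode ?F)"
    unfolding conv_lin_comb antipode_lin_comb
    by (rule lin_comb_reindex[where h = "\<lambda>(i, j). (j, i)"])
      (auto intro!: bij_betwI[where g = "\<lambda>(i, j). (j, i)"] simp: power_add mult_ac)
  thus ?thesis by (simp only: lin_comb_self[OF assms(1), symmetric] lin_comb_self[OF assms(2), symmetric])
qed

section \<open>Classes in the enveloping algebra\<close>

context
  fixes scale :: "'k::real_normed_field \<Rightarrow> 'a::ab_group_add \<Rightarrow> 'a"
    and br :: "'a \<Rightarrow> 'a \<Rightarrow> 'a"
begin

lemma ideal_uea_ideal: "ideal (uea_ideal scale br) free_alg"
  unfolding uea_ideal_def
  by (intro ring.genideal_ideal[OF ring_free_alg])
    (auto intro!: free_alg_diff_closed word_monom_carrier)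

lemma uea_ideal_subset:
  assumes "ideal J free_alg"
    and "\<And>x y. (\<lambda>w. word_monom 1 [x + y] w - word_monom 1 [x] w - word_monom 1 [y] w) \<in> J"
    and "\<And>c x. (\<lambda>w. word_monom 1 [scale c x] w - word_monom c [x] w) \<in> J"
    and "\<And>x y. (\<lambda>w. word_monom 1 [x, y] w - word_monom 1 [y, x] w - word_monom 1 [br x y] w) \<in> J"
  shows "uea_ideal scale br \<subseteq> J"
  unfolding uea_ideal_def
  by (intro ring.genideal_minimal[OF ring_free_alg assms(1)]) (use assms(2-) in auto)

lemma uea_ideal_gens:
  "(\<lambda>w. word_monom 1 [x + y] w - word_monom 1 [x] w - word_monom 1 [y] w) \<in> uea_ideal scale br"
  "(\<lambda>w. word_monom 1 [scale c x] w - word_monom c [x] w) \<in> uea_ideal scale br"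
  "(\<lambda>w. word_monom 1 [x, y] w - word_monom 1 [y, x] w - word_monom 1 [br x y] w) \<in> uea_ideal scale br"
proof -
  let ?G = "{(\<lambda>w. word_monom 1 [x + y] w - word_monom 1 [x] w - word_monom 1 [y] w) | x y. True}
      \<union> {(\<lambda>w. word_monom 1 [scale c x] w - word_monom c [x] w) | c x. True}
      \<union> {(\<lambda>w. word_monom 1 [x, y] w - word_monom 1 [y, x] w - word_monom 1 [br x y] w) | x y. True}"
  have "?G \<subseteq> uea_ideal scale br"
    unfolding uea_ideal_def
    by (intro ring.genideal_self[OF ring_free_alg])
      (auto intro!: free_alg_diff_closed word_monom_carrier)
  thus "(\<lambda>w. word_monom 1 [x + y] w - word_monom 1 [x] w - word_monom 1 [y] w) \<in> uea_ideal scale br"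
    "(\<lambda>w. word_monom 1 [scale c x] w - word_monom c [x] w) \<in> uea_ideal scale br"
    "(\<lambda>w. word_monom 1 [x, y] w - word_monom 1 [y, x] w - word_monom 1 [br x y] w) \<in> uea_ideal scale br"
    by blast+
qed

lemma ring_uea: "ring (uea scale br)"
  unfolding uea_def by (rule ideal.quotient_is_ring[OF ideal_uea_ideal])

lemma uea_class_hom: "uea_class scale br \<in> ring_hom free_alg (uea scale br)"
  using ideal.rcos_ring_hom[OF ideal_uea_ideal[of]] unfolding uea_def uea_class_def[abs_def] .

lemma uea_class_closed: "f \<in> carrier free_alg \<Longrightarrow> uea_class scale br f \<in> carrier (uea scale br)"
  using uea_class_hom by (rule ring_hom_closed)

lemma uea_class_mult:
  "f \<in> carrier free_alg \<Longrightarrow> g \<in> carrier free_alg \<Longrightarrow>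
    uea_class scale br f \<otimes>\<^bsub>uea scale br\<^esub> uea_class scale br g = uea_class scale br (conv f g)"
  by (simp add: ring_hom_mult[OF uea_class_hom])

lemma uea_class_add:
  "f \<in> carrier free_alg \<Longrightarrow> g \<in> carrier free_alg \<Longrightarrow>
    uea_class scale br f \<oplus>\<^bsub>uea scale br\<^esub> uea_class scale br g = uea_class scale br (\<lambda>w. f w + g w)"
  by (simp add: ring_hom_add[OF uea_class_hom] flip: free_alg_add)

lemma uea_class_one: "\<one>\<^bsub>uea scale br\<^esub> = uea_class scale br (word_monom 1 [])"
  by (simp add: ring_hom_one[OF uea_class_hom] flip: free_alg_one)

lemma uea_class_zero: "\<zero>\<^bsub>uea scale br\<^esub> = uea_class scale br (\<lambda>w. 0)"
proof -
  have "uea_class scale br \<zero>\<^bsub>free_alg\<^esub> = \<zero>\<^bsub>uea scale br\<^esub>"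
    by (rule ring_hom_zero[OF uea_class_hom ring_free_alg ring_uea])
  thus ?thesis by (simp add: free_alg_zero)
qed

lemma uea_class_finsum:
  assumes "finite I" "\<And>i. i \<in> I \<Longrightarrow> F i \<in> carrier free_alg"
  shows "(\<Oplus>\<^bsub>uea scale br\<^esub>i\<in>I. uea_class scale br (F i)) = uea_class scale br (\<lambda>w. \<Sum>i\<in>I. F i w)
    \<and> (\<lambda>w. \<Sum>i\<in>I. F i w) \<in> carrier free_alg"
proof -
  interpret U: ring "uea scale br" by (rule ring_uea)
  show ?thesis using assms
  proof (induction I rule: finite_induct)
    case empty
    thus ?case by (simp add: uea_class_zero free_alg_carrier)
  next
    case (insert i I)
    thus ?case
      by (subst U.finsum_insert) (auto simp: uea_class_closed uea_class_add free_alg_add_closed)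
  qed
qed

lemma uea_class_self:
  assumes "f \<in> carrier free_alg"
  shows "f \<in> uea_class scale br f"
proof -
  interpret ideal "uea_ideal scale br" free_alg by (rule ideal_uea_ideal)
  show ?thesis unfolding uea_class_def by (rule a_rcos_self[OF assms])
qed

lemma uea_class_memE:
  assumes "f \<in> carrier free_alg" "g \<in> uea_class scale br f"
  obtains h where "h \<in> uea_ideal scale br" "h \<in> carrier free_alg" "g = (\<lambda>w. h w + f w)" "g \<in> carrier free_alg"
proof -
  interpret ideal "uea_ideal scale br" free_alg by (rule ideal_uea_ideal)
  obtain h where h: "h \<in> uea_ideal scale br" "g = (\<lambda>w. h w + f w)"
    using assms(2) unfolding uea_class_def a_r_coset_def r_coset_def by (auto simp: free_alg_add)
  moreover have "h \<in> carrier free_alg" using h a_Hcarr by simp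
  ultimately show thesis using that free_alg_add_closed assms(1) by blast
qed

lemma uea_class_eqI:
  assumes "f \<in> carrier free_alg" "h \<in> uea_ideal scale br" "g = (\<lambda>w. h w + f w)"
  shows "uea_class scale br g = uea_class scale br f"
proof -
  interpret ideal "uea_ideal scale br" free_alg by (rule ideal_uea_ideal)
  have "g \<in> uea_class scale br f"
    unfolding uea_class_def a_r_coset_def r_coset_def using assms by (auto simp: free_alg_add)
  thus ?thesis unfolding uea_class_def
    using a_repr_independence[OF _ assms(1) a_subgroup] by metis
qed

lemma uea_class_word_add:
  "uea_class scale br (word_monom 1 [x + y]) = uea_class scale br (\<lambda>w. word_monom 1 [x] w + word_monom 1 [y] w)"
  by (rule uea_class_eqI[OF _ uea_ideal_gens(1)[of x y]])
    (auto intro!: free_alg_add_closed word_monom_carrier)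

lemma uea_class_word_scale:
  "uea_class scale br (word_monom 1 [scale c x]) = uea_class scale br (word_monom c [x])"
  by (rule uea_class_eqI[OF _ uea_ideal_gens(2)[of c x]]) (auto intro!: word_monom_carrier)

lemma uea_class_word_bracket:
  "uea_class scale br (word_monom 1 [br x y]) =
    uea_class scale br (\<lambda>w. word_monom 1 [x, y] w + word_monom (- 1) [y, x] w)"
proof -
  have "uea_class scale br (\<lambda>w. word_monom 1 [x, y] w + word_monom (- 1) [y, x] w) =
      uea_class scale br (word_monom 1 [br x y])"
    by (rule uea_class_eqI[OF _ uea_ideal_gens(3)[of x y]]) 
      (auto simp: word_monom_def fun_eq_iff intro!: word_monom_carrier[unfolded word_monom_def])
  thus ?thesis by simp
qed

end

section \<open>The action of the enveloping algebra\<close>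

text \<open>The \<open>f\<close> on which \<open>e\<close> vanishes form a two-sided ideal that
  contains the relations, hence all of \<open>uea_ideal\<close>. Vanishing is asked for each factor
  separately, instead of multiplicativity of \<open>e\<close>, so that the order-reversing action
  through the antipode fits as well as the action itself.\<close>

lemma uea_class_additive_cong:
  fixes scale :: "'k::real_normed_field \<Rightarrow> 'a::ab_group_add \<Rightarrow> 'a" and br :: "'a \<Rightarrow> 'a \<Rightarrow> 'a"
    and e :: "('a list \<Rightarrow> 'k) \<Rightarrow> 'v \<Rightarrow> 'w::ab_group_add"
  assumes add: "\<And>f g v. f \<in> carrier free_alg \<Longrightarrow> g \<in> carrier free_alg \<Longrightarrow>
        e (\<lambda>w. f w + g w) v = e f v + e g v"
    and left: "\<And>f g v. f \<in> carrier free_alg \<Longrightarrow> g \<in> carrier free_alg \<Longrightarrow> (\<And>v. e f v = 0) \<Longrightarrow>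
        e (conv f g) v = 0"
    and right: "\<And>f g v. f \<in> carrier free_alg \<Longrightarrow> g \<in> carrier free_alg \<Longrightarrow> (\<And>v. e g v = 0) \<Longrightarrow>
        e (conv f g) v = 0"
    and gens: "\<And>x y v. e (word_monom 1 [x + y]) v = e (word_monom 1 [x]) v + e (word_monom 1 [y]) v"
      "\<And>c x v. e (word_monom 1 [scale c x]) v = e (word_monom c [x]) v"
      "\<And>x y v. e (word_monom 1 [x, y]) v = e (word_monom 1 [y, x]) v + e (word_monom 1 [br x y]) v"
    and f: "f \<in> carrier free_alg" and g: "g \<in> uea_class scale br f"
  shows "e g v = e f v"
proof -
  let ?K = "{f \<in> carrier free_alg. \<forall>v. e f v = 0}"
  have zero: "e (\<lambda>w. 0) v = 0" for v
    using add[of "\<lambda>w. 0" "\<lambda>w. 0" v] by (simp add: free_alg_carrier)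
  have minus: "e (\<lambda>w. - f w) v = - e f v" if "f \<in> carrier free_alg" for f v
    using add[OF that free_alg_uminus_closed[OF that], of v] zero by (simp add: eq_neg_iff_add_eq_0 add.commute)
  have diff: "e (\<lambda>w. f w - g w) v = e f v - e g v"
    if "f \<in> carrier free_alg" "g \<in> carrier free_alg" for f g v
    using add[OF that(1) free_alg_uminus_closed[OF that(2)], of v] minus[OF that(2)] by simp
  interpret F: ring "free_alg :: ('a list \<Rightarrow> 'k) ring" by (rule ring_free_alg)
  have inv: "\<ominus>\<^bsub>free_alg\<^esub> f = (\<lambda>w. - f w)" if "f \<in> carrier free_alg" for f :: "'a list \<Rightarrow> 'k"
    using that free_alg_uminus_closed[OF that]
    by (intro F.minus_equality) (auto simp: free_alg_add free_alg_zero)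
  have "ideal ?K free_alg"
  proof (rule idealI[OF ring_free_alg])
    show "subgroup ?K (add_monoid free_alg)"
      by (rule F.add.subgroupI)
        (auto simp: inv minus free_alg_add add free_alg_add_closed free_alg_uminus_closed
          simp flip: a_inv_def intro!: exI[of _ "\<lambda>w. 0"] zero, simp add: free_alg_carrier)
  qed (auto simp: conv_closed left right)
  hence "uea_ideal scale br \<subseteq> ?K"
  proof (rule uea_ideal_subset)
    have *: "(\<lambda>w. f w - g w) \<in> ?K" if "f \<in> carrier free_alg" "g \<in> carrier free_alg" "\<And>v. e f v = e g v"
      for f g :: "'a list \<Rightarrow> 'k"
      using that diff[OF that(1,2)] free_alg_diff_closed[OF that(1,2)] by simp
    have **: "(\<lambda>w. f w - g w - h w) \<in> ?K"
      if "f \<in> carrier free_alg" "g \<in> carrier free_alg" "h \<in> carrier free_alg" "\<And>v. e f v = e g v + e h v"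
      for f g h :: "'a list \<Rightarrow> 'k"
      using *[of f "\<lambda>w. g w + h w"] that by (simp add: add free_alg_add_closed diff_diff_eq)
    show "(\<lambda>w. word_monom 1 [x + y] w - word_monom 1 [x] w - word_monom 1 [y] w) \<in> ?K" for x y
      by (rule **[OF word_monom_carrier word_monom_carrier word_monom_carrier gens(1)])
    show "(\<lambda>w. word_monom 1 [scale c x] w - word_monom c [x] w) \<in> ?K" for c x
      by (rule *[OF word_monom_carrier word_monom_carrier gens(2)])
    show "(\<lambda>w. word_monom 1 [x, y] w - word_monom 1 [y, x] w - word_monom 1 [br x y] w) \<in> ?K" for x y
      by (rule **[OF word_monom_carrier word_monom_carrier word_monom_carrier gens(3)])
  qed
  moreover obtain h where "h \<in> uea_ideal scale br" and "h \<in> carrier free_alg" "g = (\<lambda>w. h w + f w)"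
    using uea_class_memE[OF f g] by metis
  ultimately show ?thesis using add f by auto
qed

locale lie_eval = vector_space s
  for s :: "'k::real_normed_field \<Rightarrow> 'w::ab_group_add \<Rightarrow> 'w" +
  fixes scale :: "'k::real_normed_field \<Rightarrow> 'a::ab_group_add \<Rightarrow> 'a" and br :: "'a \<Rightarrow> 'a \<Rightarrow> 'a" and \<sigma> :: "'a \<Rightarrow> 'w \<Rightarrow> 'w"
  assumes act_add_vec: "\<sigma> x (u + v) = \<sigma> x u + \<sigma> x v"
    and act_scale_vec: "\<sigma> x (s c v) = s c (\<sigma> x v)"
    and act_add: "\<sigma> (x + y) v = \<sigma> x v + \<sigma> y v"
    and act_scale: "\<sigma> (scale c x) v = s c (\<sigma> x v)"
    and act_bracket: "\<sigma> (br x y) v = \<sigma> x (\<sigma> y v) - \<sigma> y (\<sigma> x v)"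
begin

definition uact :: "('a list \<Rightarrow> 'k) \<Rightarrow> 'w \<Rightarrow> 'w" where
  "uact f v = (\<Sum>w | f w \<noteq> 0. s (f w) (foldr \<sigma> w v))"

lemma act_zero_vec [simp]: "\<sigma> x 0 = 0"
  using act_add_vec[of x 0 0] by simp

lemma act_zero [simp]: "\<sigma> 0 v = 0"
  using act_add[of 0 0 v] by simp

lemma word_add: "foldr \<sigma> w (u + v) = foldr \<sigma> w u + foldr \<sigma> w v"
  by (induction w) (auto simp: act_add_vec)

lemma word_scale: "foldr \<sigma> w (s c v) = s c (foldr \<sigma> w v)"
  by (induction w) (auto simp: act_scale_vec)

lemma word_zero [simp]: "foldr \<sigma> w 0 = 0"
  by (induction w) auto

lemma word_sum: "foldr \<sigma> w (\<Sum>i\<in>I. g i) = (\<Sum>i\<in>I. foldr \<sigma> w (g i))"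
  by (induction I rule: infinite_finite_induct) (auto simp: word_add)

lemma word_zero_letter: "0 \<in> set w \<Longrightarrow> foldr \<sigma> w v = 0"
  by (induction w) auto

lemma act_sum: "\<sigma> (\<Sum>i\<in>I. x i) v = (\<Sum>i\<in>I. \<sigma> (x i) v)"
  by (induction I rule: infinite_finite_induct) (auto simp: act_add)

lemma uact_superset:
  assumes "finite A" "{w. f w \<noteq> 0} \<subseteq> A"
  shows "uact f v = (\<Sum>w\<in>A. s (f w) (foldr \<sigma> w v))"
  unfolding uact_def using assms by (intro sum.mono_neutral_left) auto

lemma uact_lin_comb:
  assumes "finite I"
  shows "uact (lin_comb I a u) v = (\<Sum>i\<in>I. s (a i) (foldr \<sigma> (u i) v))"
proof -
  have "uact (lin_comb I a u) v = (\<Sum>w\<in>u ` I. s (lin_comb I a u w) (foldr \<sigma> w v))"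
    using assms by (intro uact_superset lin_comb_nonzero) auto
  also have "\<dots> = (\<Sum>w\<in>u ` I. \<Sum>i\<in>I. s (word_monom (a i) (u i) w) (foldr \<sigma> w v))"
    by (simp add: lin_comb_def scale_sum_left)
  also have "\<dots> = (\<Sum>i\<in>I. \<Sum>w\<in>u ` I. if w = u i then s (a i) (foldr \<sigma> (u i) v) else 0)"
    by (subst sum.swap) (auto simp: word_monom_def intro!: sum.cong)
  also have "\<dots> = (\<Sum>i\<in>I. s (a i) (foldr \<sigma> (u i) v))"
    using assms by (intro sum.cong) auto
  finally show ?thesis .
qed

lemma uact_word_monom: "uact (word_monom c w) v = s c (foldr \<sigma> w v)"
  by (simp add: word_monom_lin_comb uact_lin_comb)

lemma uact_add:
  assumes "f \<in> carrier free_alg" "g \<in> carrier free_alg"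
  shows "uact (\<lambda>w. f w + g w) v = uact f v + uact g v"
proof -
  let ?A = "{w. f w \<noteq> 0} \<union> {w. g w \<noteq> 0}"
  have A: "finite ?A" using assms by (simp add: free_alg_carrier)
  show ?thesis
    by (subst (1 2 3) uact_superset[OF A]) (auto simp: scale_left_distrib sum.distrib)
qed

lemma uact_sum:
  assumes "finite I" "\<And>i. i \<in> I \<Longrightarrow> F i \<in> carrier free_alg"
  shows "uact (\<lambda>w. \<Sum>i\<in>I. F i w) v = (\<Sum>i\<in>I. uact (F i) v) \<and> (\<lambda>w. \<Sum>i\<in>I. F i w) \<in> carrier free_alg"
  using assms
proof (induction I rule: finite_induct)
  case empty
  thus ?case by (simp add: uact_def free_alg_carrier)
next
  case (insert i I)
  thus ?case by (simp add: uact_add free_alg_add_closed)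
qed

lemma uact_vec_add: "uact f (u + v) = uact f u + uact f v"
  by (simp add: uact_def word_add scale_right_distrib sum.distrib)

lemma uact_vec_zero [simp]: "uact f 0 = 0"
  by (simp add: uact_def)

text \<open>\<open>foldr \<sigma>\<close> turns concatenation of words into composition; the rest is
  bilinearity.\<close>

lemma uact_conv:
  assumes "f \<in> carrier free_alg" "g \<in> carrier free_alg"
  shows "uact (conv f g) v = uact f (uact g v)"
proof -
  let ?F = "lin_comb {w. f w \<noteq> 0} f id" and ?G = "lin_comb {w. g w \<noteq> 0} g id"
  have fin: "finite {w. f w \<noteq> 0}" "finite {w. g w \<noteq> 0}" using assms by (auto simp: free_alg_carrier)
  have "uact (conv ?F ?G) v = uact ?F (uact ?G v)"
    unfolding conv_lin_comb using fin
    by (simp add: uact_lin_comb word_sum word_scale scale_sum_right sum.cartesian_product case_prod_unfold)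
  thus ?thesis by (simp only: lin_comb_self[OF assms(1), symmetric] lin_comb_self[OF assms(2), symmetric])
qed

lemma uact_class:
  assumes "f \<in> carrier free_alg" "g \<in> uea_class scale br f"
  shows "uact g v = uact f v"
  by (rule uea_class_additive_cong[where e = uact and br = br and scale = scale, OF _ _ _ _ _ _ assms])
    (auto simp: uact_add uact_conv uact_word_monom act_add act_scale act_bracket)

text \<open>The antipode exchanges the two factors of a product. The bracket relation survives
  because words of length 2 are reversed without a sign, so their commutator changes sign together
  with the negated letter \<open>br x y\<close>.\<close>

lemma uact_antipode_class:
  assumes "f \<in> carrier free_alg" "g \<in> uea_class scale br f"
  shows "uact (antipode g) v = uact (antipode f) v"
proof (rule uea_class_additive_cong[where e = "\<lambda>f. uact (antipode f)" and br = br and scale = scale,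
      OF _ _ _ _ _ _ assms])
  show "uact (antipode (\<lambda>w. f w + g w)) v = uact (antipode f) v + uact (antipode g) v"
    if "f \<in> carrier free_alg" "g \<in> carrier free_alg" for f g v
  proof -
    have "antipode (\<lambda>w. f w + g w) = (\<lambda>w. antipode f w + antipode g w)"
      by (simp add: antipode_def distrib_left fun_eq_iff)
    thus ?thesis using that by (simp add: uact_add antipode_closed)
  qed
qed (auto simp: antipode_conv antipode_closed uact_conv antipode_word_monom uact_word_monom act_add act_scale
      act_bracket scale_right_distrib)

end

section \<open>Words in the generators\<close>

text \<open>Generation is a statement about the whole algebra, while the induction is degree by
  degree. The homogeneous vectors satisfying \<open>P\<close> span a subalgebra containing
  \<open>gr 1\<close>, hence everything; uniqueness of the decomposition then brings the result back
  to the single degree \<open>k\<close>.\<close>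

lemma (in graded_lie_algebra) graded_induct:
  assumes x: "x \<in> gr k"
    and zero: "\<And>k. P k 0" and add: "\<And>k x y. P k x \<Longrightarrow> P k y \<Longrightarrow> P k (x + y)"
    and scale: "\<And>k c x. P k x \<Longrightarrow> P k (scale c x)"
    and bracket: "\<And>k m x y. P k x \<Longrightarrow> P m y \<Longrightarrow> P (k + m) (br x y)"
    and gen: "\<And>x. x \<in> gr 1 \<Longrightarrow> P 1 x"
  shows "P k x"
proof -
  define T where "T k = {x \<in> gr k. P k x}" for k
  have T: "0 \<in> T k" "x \<in> T k \<Longrightarrow> y \<in> T k \<Longrightarrow> x + y \<in> T k" "x \<in> T k \<Longrightarrow> scale c x \<in> T k" for k c x y
    using gr_subspace[of k] by (auto simp: T_def zero add scale subspace_0 subspace_add subspace_scale)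
  have br0: "br x 0 = 0" "br 0 x = 0" for x
    using br_scale_right[of x 0 0] br_scale_left[of 0 0 x] by auto
  let ?S = "span (\<Union>k. T k)"
  \<comment> \<open>Span induction varies one argument at a time: the left factor is kept
    homogeneous here and released in \<open>br2\<close>.\<close>
  have br1: "br x y \<in> ?S" if "x \<in> T k" "y \<in> ?S" for k x y
    using that(2)
  proof (induction rule: span_induct_alt)
    case base
    show ?case by (simp add: br0 span_zero)
  next
    case (step c z y)
    then obtain m where m: "z \<in> T m" by auto
    have "br x z \<in> T (k + m)"
      using m that(1) by (auto simp: T_def gr_bracket bracket)
    hence "br x z \<in> ?S" by (auto intro: span_base)
    thus ?case using step by (simp add: br_add_right br_scale_right span_add span_scale)
  qed
  have br2: "br x y \<in> ?S" if "x \<in> ?S" "y \<in> ?S" for x y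
    using that(1)
  proof (induction rule: span_induct_alt)
    case base
    show ?case by (simp add: br0 span_zero)
  next
    case (step c z y')
    then obtain m where m: "z \<in> T m" by auto
    show ?case using step br1[OF m that(2)] by (simp add: br_add_left br_scale_left span_add span_scale)
  qed
  have "?S = UNIV"
  proof (rule gr_generated)
    show "gr 1 \<subseteq> ?S"
      using gen by (intro subsetI span_base) (auto simp: T_def)
  qed (auto intro: br2)
  hence "x \<in> ?S" by simp
  \<comment> \<open>A finite set \<open>F\<close> around the support is carried along, since
    components may cancel when they are added and the exact support is not stable.\<close>
  hence "\<exists>c F. finite F \<and> (\<forall>k. c k \<in> T k) \<and> (\<forall>k. k \<notin> F \<longrightarrow> c k = 0) \<and> x = (\<Sum>k\<in>F. c k)"
  proof (induction rule: span_induct_alt)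
    case base
    show ?case by (rule exI[of _ "\<lambda>_. 0"], rule exI[of _ "{}"]) (auto simp: T)
  next
    case (step a z y)
    then obtain m c F where m: "z \<in> T m" and c: "finite F" "\<forall>k. c k \<in> T k" "\<forall>k. k \<notin> F \<longrightarrow> c k = 0"
      "y = (\<Sum>k\<in>F. c k)" by auto
    have "y = (\<Sum>k\<in>insert m F. c k)"
      unfolding c(4) using c(1,3) by (intro sum.mono_neutral_left) auto
    hence "scale a z + y = (\<Sum>k\<in>insert m F. (if k = m then scale a z else 0) + c k)"
      using c(1) by (subst sum.distrib) auto
    thus ?case using c m
      by (intro exI[of _ "\<lambda>k. (if k = m then scale a z else 0) + c k"] exI[of _ "insert m F"])
        (auto simp: T)
  qed
  then obtain c F where c: "finite F" "\<forall>k. c k \<in> T k" "\<forall>k. k \<notin> F \<longrightarrow> c k = 0" "x = (\<Sum>k\<in>F. c k)" by auto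
  have "{k. c k \<noteq> 0} \<subseteq> F" using c(3) by auto
  hence c1: "(\<forall>k. c k \<in> gr k) \<and> finite {k. c k \<noteq> 0} \<and> x = (\<Sum>k | c k \<noteq> 0. c k)"
    using c sum.mono_neutral_right[OF c(1) \<open>{k. c k \<noteq> 0} \<subseteq> F\<close>, of c] finite_subset[OF _ c(1)]
    by (simp add: T_def)
  \<comment> \<open>The second decomposition of \<open>x\<close>, concentrated in degree
    \<open>k\<close>, to be compared with \<open>c\<close>.\<close>
  let ?d = "\<lambda>j. if j = k then x else 0"
  have supp: "{j. ?d j \<noteq> 0} = (if x = 0 then {} else {k})" by auto
  have d1: "(\<forall>k. ?d k \<in> gr k) \<and> finite {k. ?d k \<noteq> 0} \<and> x = (\<Sum>k | ?d k \<noteq> 0. ?d k)"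
    unfolding supp using x subspace_0[OF gr_subspace] by (cases "x = 0") simp_all
  define Q where "Q c \<longleftrightarrow> (\<forall>k. c k \<in> gr k) \<and> finite {k. c k \<noteq> 0} \<and> x = (\<Sum>k | c k \<noteq> 0. c k)"
    for c :: "nat \<Rightarrow> 'a"
  have "\<exists>!c. Q c" unfolding Q_def by (rule gr_direct_sum)
  moreover have "Q c" "Q ?d" using c1 d1 unfolding Q_def by blast+
  ultimately have "c = ?d" by blast
  hence "x = c k" by simp
  thus ?thesis using c(2) by (auto simp: T_def)
qed

section \<open>Representatives by words whose length is the degree\<close>

context
  fixes scale :: "'k::real_normed_field \<Rightarrow> 'a::ab_group_add \<Rightarrow> 'a"
    and br :: "'a \<Rightarrow> 'a \<Rightarrow> 'a" and \<Omega> :: "'a set"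
begin

text \<open>The coefficient function \<open>c\<close> is a member of the family over which
  \<open>unorm\<close> takes its infimum, so \<open>word_rep p f\<close> says that this family is
  nonempty for the class of \<open>f\<close>.\<close>

definition word_rep :: "nat \<Rightarrow> ('a list \<Rightarrow> 'k) \<Rightarrow> bool" where
  "word_rep p f \<longleftrightarrow> f \<in> carrier free_alg \<and> (\<exists>c\<in>carrier free_alg.
     (\<forall>w. c w \<noteq> 0 \<longrightarrow> length w = p \<and> set w \<subseteq> \<Omega>) \<and> uea_class scale br f = uea_class scale br c)"

lemma word_rep_self:
  assumes "f \<in> carrier free_alg" "\<And>w. f w \<noteq> 0 \<Longrightarrow> length w = p \<and> set w \<subseteq> \<Omega>"
  shows "word_rep p f"
  using assms unfolding word_rep_def by blast

lemma word_rep_cong: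
  assumes "word_rep p f" "g \<in> carrier free_alg" "uea_class scale br g = uea_class scale br f"
  shows "word_rep p g"
  using assms unfolding word_rep_def by metis

lemma word_rep_add:
  assumes "word_rep p f" "word_rep p g"
  shows "word_rep p (\<lambda>w. f w + g w)"
proof -
  obtain c d where c: "c \<in> carrier free_alg" "\<forall>w. c w \<noteq> 0 \<longrightarrow> length w = p \<and> set w \<subseteq> \<Omega>"
      "uea_class scale br f = uea_class scale br c"
    and d: "d \<in> carrier free_alg" "\<forall>w. d w \<noteq> 0 \<longrightarrow> length w = p \<and> set w \<subseteq> \<Omega>"
      "uea_class scale br g = uea_class scale br d"
    and fg: "f \<in> carrier free_alg" "g \<in> carrier free_alg"
    using assms unfolding word_rep_def by blast
  have "word_rep p (\<lambda>w. c w + d w)"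
  proof (rule word_rep_self)
    fix w assume "c w + d w \<noteq> 0"
    hence "c w \<noteq> 0 \<or> d w \<noteq> 0" by auto
    thus "length w = p \<and> set w \<subseteq> \<Omega>" using c(2) d(2) by blast
  qed (use c d in \<open>auto intro: free_alg_add_closed\<close>)
  thus ?thesis
    by (rule word_rep_cong) (use c d fg in \<open>auto simp: free_alg_add_closed simp flip: uea_class_add\<close>)
qed

lemma word_rep_conv:
  assumes "word_rep p f" "word_rep q g"
  shows "word_rep (p + q) (conv f g)"
proof -
  obtain c d where c: "c \<in> carrier free_alg" "\<forall>w. c w \<noteq> 0 \<longrightarrow> length w = p \<and> set w \<subseteq> \<Omega>"
      "uea_class scale br f = uea_class scale br c"
    and d: "d \<in> carrier free_alg" "\<forall>w. d w \<noteq> 0 \<longrightarrow> length w = q \<and> set w \<subseteq> \<Omega>"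
      "uea_class scale br g = uea_class scale br d"
    and fg: "f \<in> carrier free_alg" "g \<in> carrier free_alg"
    using assms unfolding word_rep_def by blast
  have "length w = p + q \<and> set w \<subseteq> \<Omega>" if nz: "conv c d w \<noteq> 0" for w
  proof -
    obtain i where i: "i \<le> length w" "c (take i w) \<noteq> 0" "d (drop i w) \<noteq> 0"
      using sum.not_neutral_contains_not_neutral[OF nz[unfolded free_alg_mult]] by auto
    hence "length (take i w) = p" "length (drop i w) = q" "set (take i w) \<union> set (drop i w) \<subseteq> \<Omega>"
      using c(2) d(2) by blast+
    hence "length (take i w @ drop i w) = p + q" "set (take i w @ drop i w) \<subseteq> \<Omega>"
      by (simp_all only: length_append set_append)
    thus ?thesis by simp
  qed
  hence "word_rep (p + q) (conv c d)"
    using c d by (intro word_rep_self conv_closed) auto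
  thus ?thesis
    by (rule word_rep_cong) (use c d fg in \<open>auto simp: conv_closed simp flip: uea_class_mult\<close>)
qed

lemma word_rep_zero: "word_rep p (\<lambda>w. 0)"
  by (rule word_rep_self) (auto simp: free_alg_carrier)

lemma word_rep_const: "word_rep 0 (word_monom c [])"
  by (rule word_rep_self) (auto simp: word_monom_carrier, auto simp: word_monom_def split: if_splits)

lemma word_rep_scale:
  assumes "word_rep p (word_monom 1 w)"
  shows "word_rep p (word_monom c w)"
  using word_rep_conv[OF word_rep_const[of c] assms] by (simp add: conv_word_monom)

lemma word_rep_letter_add:
  assumes "word_rep p (word_monom 1 [x])" "word_rep p (word_monom 1 [y])"
  shows "word_rep p (word_monom 1 [x + y])"
  by (rule word_rep_cong[OF word_rep_add[OF assms] word_monom_carrier uea_class_word_add])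

lemma word_rep_letter_scale:
  assumes "word_rep p (word_monom 1 [x])"
  shows "word_rep p (word_monom 1 [scale c x])"
  by (rule word_rep_cong[OF word_rep_scale[OF assms] word_monom_carrier uea_class_word_scale])

lemma word_rep_letter_bracket:
  assumes "word_rep p (word_monom 1 [x])" "word_rep q (word_monom 1 [y])"
  shows "word_rep (p + q) (word_monom 1 [br x y])"
proof (rule word_rep_cong[OF word_rep_add word_monom_carrier uea_class_word_bracket])
  show "word_rep (p + q) (word_monom 1 [x, y])"
    using word_rep_conv[OF assms] by (simp add: conv_word_monom)
  show "word_rep (p + q) (word_monom (- 1) [y, x])"
    using word_rep_conv[OF assms(2,1)]
    by - (rule word_rep_scale, simp add: conv_word_monom add.commute)
qed

text \<open>The letter 0 is a nonzero word of the free algebra. Its class \<open>u\<close> satisfies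
  \<open>u = u + u\<close> by additivity, hence vanishes and has a representative in every
  degree.\<close>

lemma word_rep_letter_zero: "word_rep p (word_monom 1 [0])"
proof -
  have *: "uea_class scale br (word_monom 1 [0]) =
      uea_class scale br (word_monom 1 [0]) \<oplus>\<^bsub>uea scale br\<^esub> uea_class scale br (word_monom 1 [0])"
    using uea_class_word_add[of scale br 0 0]
    by (subst uea_class_add) (simp_all add: word_monom_carrier)
  interpret U: ring "uea scale br" by (rule ring_uea)
  have cl: "uea_class scale br (word_monom 1 [0]) \<in> carrier (uea scale br)"
    by (intro uea_class_closed word_monom_carrier)
  have "uea_class scale br (word_monom 1 [0]) = \<zero>\<^bsub>uea scale br\<^esub>"
    using * U.add.l_cancel_one[OF cl cl] by metis
  thus ?thesis
    by (intro word_rep_cong[OF word_rep_zero] word_monom_carrier) (simp add: uea_class_zero)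
qed

lemma word_rep_letter_gen: "x \<in> \<Omega> \<Longrightarrow> word_rep 1 (word_monom 1 [x])"
  by (rule word_rep_self) (auto simp: word_monom_carrier, auto simp: word_monom_def split: if_splits)

text \<open>Replacing each letter of degree \<open>k\<close> by words of length \<open>k\<close> in
  the generators turns a word of total degree \<open>p\<close> into words of length
  \<open>p\<close>.\<close>

lemma uea_grade_word_rep:
  assumes letter: "\<And>k x. x \<in> gr k \<Longrightarrow> word_rep k (word_monom 1 [x])"
    and u: "u \<in> uea_grade scale br gr p"
  obtains f c where "f \<in> carrier free_alg" "u = uea_class scale br f" "c \<in> carrier free_alg"
    "\<And>w. c w \<noteq> 0 \<Longrightarrow> length w = p \<and> set w \<subseteq> \<Omega>" "u = uea_class scale br c"
proof -
  obtain f where f: "f \<in> carrier free_alg" "u = uea_class scale br f"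
    "\<And>w. f w \<noteq> 0 \<Longrightarrow> \<exists>ks. list_all2 (\<lambda>x k. x \<in> gr k) w ks \<and> sum_list ks = p"
    using u unfolding uea_grade_def by blast
  have word: "word_rep (sum_list ks) (word_monom 1 w)" if "list_all2 (\<lambda>x k. x \<in> gr k) w ks" for w ks
    using that
  proof (induction rule: list_all2_induct)
    case Nil
    show ?case using word_rep_const[of 1] by simp
  next
    case (Cons x xs k ks)
    thus ?case using word_rep_conv[OF letter[of x k] Cons.IH] by (simp add: conv_word_monom)
  qed
  have "word_rep p (lin_comb A f id)" if "finite A" "A \<subseteq> {w. f w \<noteq> 0}" for A
    using that
  proof (induction rule: finite_induct)
    case empty
    show ?case using word_rep_zero by (simp add: lin_comb_def)
  next
    case (insert w A)
    then obtain ks where "list_all2 (\<lambda>x k. x \<in> gr k) w ks" "sum_list ks = p" using f(3)[of w] by auto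
    hence "word_rep p (word_monom (f w) w)" using word word_rep_scale by metis
    from word_rep_add[OF this insert.IH] insert show ?case by (simp add: lin_comb_def)
  qed
  from this[of "{w. f w \<noteq> 0}"] have "word_rep p f"
    using f(1) lin_comb_self[OF f(1)] by (simp add: free_alg_carrier)
  thus thesis using that f unfolding word_rep_def by blast
qed

end

section \<open>Exponentials as sums over compositions\<close>

text \<open>A word of degrees encodes a product of components of a series. Degree 0 is excluded
  because \<open>\<xi> 0 = 0\<close> annihilates such products; the length is then at most the
  degree, and the cutoff in the exponential becomes automatic.\<close>

definition compositions :: "nat \<Rightarrow> nat list set" where
  "compositions p = {w. 0 \<notin> set w \<and> sum_list w = p}"

lemma finite_words_sum: "finite {w :: nat list. length w = m \<and> sum_list w = p}"
  by (rule finite_subset[OF _ finite_lists_length_eq[of "{..p}" m]])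
    (auto dest: member_le_sum_list)

lemma words_sum_UN:
  "{w :: nat list. length w \<le> p \<and> sum_list w = p} = (\<Union>m\<le>p. {w. length w = m \<and> sum_list w = p})"
  by auto

lemma finite_words_sum_le: "finite {w :: nat list. length w \<le> p \<and> sum_list w = p}"
  unfolding words_sum_UN using finite_words_sum by blast

lemma length_le_sum_list: "0 \<notin> set w \<Longrightarrow> length w \<le> sum_list w" for w :: "nat list"
  by (induction w) auto

lemma compositions_eq: "compositions p = {w. length w \<le> p \<and> sum_list w = p} - {w. 0 \<in> set w}"
  by (auto simp: compositions_def dest: length_le_sum_list)

lemma finite_compositions: "finite (compositions p)"
  unfolding compositions_eq using finite_words_sum_le by blast

lemma exp_coeff_add:
  fixes c d :: "'k::field_char_0"
  shows "(\<Sum>j\<le>n. c ^ j / fact j * (d ^ (n - j) / fact (n - j))) = (c + d) ^ n / fact n"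
  unfolding binomial_ring sum_divide_distrib
  by (intro sum.cong refl) (simp add: binomial_fact)

context
  fixes scale :: "'k::real_normed_field \<Rightarrow> 'a::ab_group_add \<Rightarrow> 'a"
    and br :: "'a \<Rightarrow> 'a \<Rightarrow> 'a" and gr :: "nat \<Rightarrow> 'a set"
begin

lemma useries_mult_rep:
  assumes "\<And>p. f p \<in> carrier free_alg" "\<And>p. g p \<in> carrier free_alg"
    and "\<And>p. y p = uea_class scale br (f p)" "\<And>p. z p = uea_class scale br (g p)"
  shows "(y \<otimes>\<^bsub>useries scale br gr\<^esub> z) p = uea_class scale br (\<lambda>w. \<Sum>i\<le>p. conv (f i) (g (p - i)) w)"
  using assms uea_class_finsum[of "{..p}" "\<lambda>i. conv (f i) (g (p - i))" scale br]
  by (simp add: useries_def uea_class_mult conv_closed)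

text \<open>Expanding the power chooses one degree for each factor. Words containing degree 0 stay
  in the sum here and drop out only when the letters act, where \<open>\<xi> 0 = 0\<close> kills
  them.\<close>

lemma lie_series_pow:
  "(lie_series scale br \<xi> [^]\<^bsub>useries scale br gr\<^esub> m) p =
     uea_class scale br (lin_comb {w. length w = m \<and> sum_list w = p} (\<lambda>_. 1) (map \<xi>))"
proof (induction m arbitrary: p)
  case 0
  have "{w :: nat list. w = [] \<and> sum_list w = p} = (if p = 0 then {[]} else {})" by auto
  thus ?case
    by (simp add: nat_pow_def useries_def uea_class_one uea_class_zero lin_comb_def)
next
  case (Suc m)
  let ?W = "\<lambda>m p. {w :: nat list. length w = m \<and> sum_list w = p}"
  let ?L = "lie_series scale br \<xi>"
  have "(?L [^]\<^bsub>useries scale br gr\<^esub> Suc m) p =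
      (?L [^]\<^bsub>useries scale br gr\<^esub> m \<otimes>\<^bsub>useries scale br gr\<^esub> ?L) p"
    by (simp add: nat_pow_def)
  also have "\<dots> = uea_class scale br
      (\<lambda>w. \<Sum>i\<le>p. conv (lin_comb (?W m i) (\<lambda>_. 1) (map \<xi>)) (word_monom 1 [\<xi> (p - i)]) w)"
    by (rule useries_mult_rep[OF _ word_monom_carrier Suc.IH])
      (simp_all add: lie_series_def lin_comb_carrier finite_words_sum)
  also have "(\<lambda>w. \<Sum>i\<le>p. conv (lin_comb (?W m i) (\<lambda>_. 1) (map \<xi>)) (word_monom 1 [\<xi> (p - i)]) w) =
      (\<lambda>w. \<Sum>(i, u)\<in>(SIGMA i:{..p}. ?W m i). word_monom 1 (map \<xi> (u @ [p - i])) w)"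
    by (simp add: lin_comb_def conv_sum_left conv_word_monom sum.Sigma finite_words_sum)
  also have "\<dots> = lin_comb (?W (Suc m) p) (\<lambda>_. 1) (map \<xi>)"
    unfolding lin_comb_def
  proof
    fix w
    show "(\<Sum>(i, u)\<in>(SIGMA i:{..p}. ?W m i). word_monom 1 (map \<xi> (u @ [p - i])) w) =
        (\<Sum>u\<in>?W (Suc m) p. word_monom 1 (map \<xi> u) w)"
    \<comment> \<open>Powers multiply the new factor on the right, so the last letter
      \<open>p - i\<close> is the one split off.\<close>
    proof (rule sum.reindex_bij_witness[where i = "\<lambda>u. (p - last u, butlast u)"
          and j = "\<lambda>(i, u). u @ [p - i]"])
      fix u assume u: "u \<in> ?W (Suc m) p"
      then obtain u' x where u': "u = u' @ [x]" by (cases u rule: rev_cases) auto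
      with u show "(case (p - last u, butlast u) of (i, u) \<Rightarrow> u @ [p - i]) = u"
        "(p - last u, butlast u) \<in> (SIGMA i:{..p}. ?W m i)"
        by auto
    qed auto
  qed
  finally show ?case .
qed

lemma useries_exp_rep:
  "useries_exp scale br gr (lie_series scale br \<xi>) p = uea_class scale br
     (lin_comb {w. length w \<le> p \<and> sum_list w = p} (\<lambda>w. 1 / fact (length w)) (map \<xi>))"
proof -
  let ?W = "\<lambda>m. {w :: nat list. length w = m \<and> sum_list w = p}"
  have lcW: "lin_comb (?W m) a (map \<xi>) \<in> carrier free_alg" for m and a :: "nat list \<Rightarrow> 'k"
    by (intro lin_comb_carrier finite_words_sum)
  have "uea_scale scale br (1 / fact m) ((lie_series scale br \<xi> [^]\<^bsub>useries scale br gr\<^esub> m) p) =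
      uea_class scale br (lin_comb (?W m) (\<lambda>w. 1 / fact (length w)) (map \<xi>))" for m
  proof -
    have "conv (word_monom (1 / fact m :: 'k) []) (lin_comb (?W m) (\<lambda>_. 1) (map \<xi>)) =
        lin_comb (?W m) (\<lambda>w. 1 / fact (length w)) (map \<xi>)"
      by (simp add: lin_comb_def conv_sum_right conv_word_monom)
    thus ?thesis
      by (simp add: uea_scale_def lie_series_pow uea_class_mult word_monom_carrier lcW)
  qed
  hence "useries_exp scale br gr (lie_series scale br \<xi>) p = uea_class scale br
      (\<lambda>w. \<Sum>m\<le>p. lin_comb (?W m) (\<lambda>w. 1 / fact (length w)) (map \<xi>) w)"
    using uea_class_finsum[of "{..p}" "\<lambda>m. lin_comb (?W m) (\<lambda>w. 1 / fact (length w)) (map \<xi>)" scale br] lcW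
    by (simp add: useries_exp_def)
  also have "(\<lambda>w. \<Sum>m\<le>p. lin_comb (?W m) (\<lambda>w. 1 / fact (length w)) (map \<xi>) w) =
      lin_comb {w. length w \<le> p \<and> sum_list w = p} (\<lambda>w. 1 / fact (length w)) (map \<xi>)"
    unfolding lin_comb_def words_sum_UN
    by (subst sum.UNION_disjoint) (auto simp: finite_words_sum)
  finally show ?thesis .
qed

end

context lie_eval
begin

text \<open>The image of the component of degree \<open>p\<close> of \<open>exp (c \<xi>)\<close>, for the series \<open>\<xi>\<close> with components \<open>\<xi> k\<close>.\<close>

definition exp_component :: "(nat \<Rightarrow> 'a) \<Rightarrow> 'k \<Rightarrow> nat \<Rightarrow> 'w \<Rightarrow> 'w" where
  "exp_component \<xi> c p v = (\<Sum>w\<in>compositions p. s (c ^ length w / fact (length w)) (foldr \<sigma> (map \<xi> w) v))"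

lemma sum_words_compositions:
  assumes "\<xi> 0 = 0"
  shows "(\<Sum>w | length w \<le> p \<and> sum_list w = p. s (a w) (foldr \<sigma> (map \<xi> w) v)) =
    (\<Sum>w\<in>compositions p. s (a w) (foldr \<sigma> (map \<xi> w) v))"
proof (rule sum.mono_neutral_right[OF finite_words_sum_le])
  show "\<forall>w\<in>{w. length w \<le> p \<and> sum_list w = p} - compositions p. s (a w) (foldr \<sigma> (map \<xi> w) v) = 0"
  proof
    fix w assume "w \<in> {w. length w \<le> p \<and> sum_list w = p} - compositions p"
    hence "0 \<in> set w" by (auto simp: compositions_def)
    hence "0 \<in> set (map \<xi> w)" using assms by force
    thus "s (a w) (foldr \<sigma> (map \<xi> w) v) = 0" using word_zero_letter by simp
  qed
qed (auto simp: compositions_eq)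

lemma uact_exp_rep:
  assumes "\<xi> 0 = 0"
  shows "uact (lin_comb {w. length w \<le> p \<and> sum_list w = p} (\<lambda>w. 1 / fact (length w)) (map \<xi>)) v = exp_component \<xi> 1 p v"
  by (simp add: uact_lin_comb finite_words_sum_le sum_words_compositions[where \<xi> = \<xi>, OF assms] exp_component_def)

text \<open>Reversing a word of degrees changes neither its length nor its sum, so only the signs of
  the letters remain, and they are the powers of \<open>c = - 1\<close>.\<close>

lemma uact_antipode_exp_rep:
  assumes "\<xi> 0 = 0"
  shows "uact (antipode (lin_comb {w. length w \<le> p \<and> sum_list w = p} (\<lambda>w. 1 / fact (length w)) (map \<xi>))) v =
    exp_component \<xi> (- 1) p v"
proof -
  have "uact (antipode (lin_comb {w. length w \<le> p \<and> sum_list w = p} (\<lambda>w. 1 / fact (length w)) (map \<xi>))) v =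
      (\<Sum>w | length w \<le> p \<and> sum_list w = p.
        s ((- 1) ^ length w / fact (length w)) (foldr \<sigma> (map \<xi> (rev w)) v))"
    by (simp add: antipode_lin_comb uact_lin_comb finite_words_sum_le rev_map)
  also have "\<dots> = (\<Sum>w | length w \<le> p \<and> sum_list w = p.
        s ((- 1) ^ length w / fact (length w)) (foldr \<sigma> (map \<xi> w) v))"
    by (rule sum.reindex_bij_witness[of _ rev rev]) auto
  finally show ?thesis
    by (simp only: sum_words_compositions[where \<xi> = \<xi>, OF assms] exp_component_def)
qed

text \<open>This is exp (c x) exp (d x) = exp ((c + d) x) in degree \<open>p\<close>. Both factors
  use words in the same letters, so once the concatenated word is fixed only scalars depend on where
  it is cut, and the binomial theorem sums them.\<close>

lemma exp_component_conv: "(\<Sum>i\<le>p. exp_component \<xi> c i (exp_component \<xi> d (p - i) v)) = exp_component \<xi> (c + d) p v"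
proof -
  define t where "t u w = s (c ^ length u / fact (length u) * (d ^ length w / fact (length w)))
    (foldr \<sigma> (map \<xi> (u @ w)) v)" for u w
  have "exp_component \<xi> c i (exp_component \<xi> d j v) = (\<Sum>(u, w)\<in>compositions i \<times> compositions j. t u w)" for i j
    by (simp add: exp_component_def t_def word_sum word_scale scale_sum_right sum.cartesian_product)
  hence "(\<Sum>i\<le>p. exp_component \<xi> c i (exp_component \<xi> d (p - i) v)) =
      (\<Sum>(i, u, w)\<in>(SIGMA i:{..p}. compositions i \<times> compositions (p - i)). t u w)"
    by (simp add: sum.Sigma finite_compositions)
  \<comment> \<open>Compositions of \<open>i\<close> and \<open>p - i\<close> together are one
    composition of \<open>p\<close> with a cut position \<open>j\<close>; \<open>i\<close> is
    recovered as the sum before the cut.\<close>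
  also have "\<dots> = (\<Sum>(w, j)\<in>(SIGMA w:compositions p. {..length w}). t (take j w) (drop j w))"
  proof (rule sum.reindex_bij_witness[where j = "\<lambda>(i, u, w). (u @ w, length u)"
        and i = "\<lambda>(w, j). (sum_list (take j w), take j w, drop j w)"])
    fix b assume "b \<in> (SIGMA w:compositions p. {..length w})"
    then obtain w j where b: "b = (w, j)" "w \<in> compositions p" "j \<le> length w" by auto
    have "sum_list (take j w) + sum_list (drop j w) = sum_list w"
      by (metis append_take_drop_id sum_list_append)
    with b show "(case b of (w, j) \<Rightarrow> (sum_list (take j w), take j w, drop j w)) \<in>
        (SIGMA i:{..p}. compositions i \<times> compositions (p - i))"
      by (auto simp: compositions_def dest: in_set_takeD in_set_dropD)
  qed (auto simp: compositions_def)
  also have "\<dots> = (\<Sum>w\<in>compositions p. \<Sum>j\<le>length w. t (take j w) (drop j w))"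
    by (simp add: sum.Sigma finite_compositions)
  also have "\<dots> = exp_component \<xi> (c + d) p v"
    unfolding exp_component_def
  proof (intro sum.cong refl)
    fix w
    have "(\<Sum>j\<le>length w. t (take j w) (drop j w)) =
        s (\<Sum>j\<le>length w. c ^ j / fact j * (d ^ (length w - j) / fact (length w - j))) (foldr \<sigma> (map \<xi> w) v)"
      unfolding scale_sum_left t_def by (intro sum.cong refl) simp
    thus "(\<Sum>j\<le>length w. t (take j w) (drop j w)) =
        s ((c + d) ^ length w / fact (length w)) (foldr \<sigma> (map \<xi> w) v)"
      by (simp only: exp_coeff_add)
  qed
  finally show ?thesis .
qed

text \<open>Since \<open>0 ^ 0 = 1\<close>, exactly the empty word survives, and it is a composition
  of 0 only.\<close>

lemma exp_component_0: "exp_component \<xi> 0 p v = (if p = 0 then v else 0)"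
proof -
  have "exp_component \<xi> 0 p v = (\<Sum>w\<in>compositions p. if w = [] then v else 0)"
    unfolding exp_component_def by (intro sum.cong refl) (simp add: power_0_left)
  also have "\<dots> = (if p = 0 then v else 0)"
    using finite_compositions by (auto simp: compositions_def)
  finally show ?thesis .
qed

end

section \<open>Convergence in a finite-dimensional complex space\<close>

locale fd_complex = finite_dimensional_vector_space sW BW
  for sW :: "complex \<Rightarrow> 'w::ab_group_add \<Rightarrow> 'w" and BW :: "'w set"
begin

abbreviation "functional \<equiv> Vector_Spaces.linear sW ((*) :: complex \<Rightarrow> complex \<Rightarrow> complex)"
abbreviation "operator \<equiv> Vector_Spaces.linear sW sW"
abbreviation "coord v b \<equiv> representation BW v b"

text \<open>The l1 norm of the coordinates in \<open>BW\<close>. The type of \<open>W\<close>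
  carries no topology, so absolute convergence is measured with this norm and transferred to
  \<open>fd_sums\<close> through the boundedness of functionals.\<close>

definition nrm :: "'w \<Rightarrow> real" where
  "nrm v = (\<Sum>b\<in>BW. cmod (coord v b))"

lemma functional_iff:
  "functional \<phi> \<longleftrightarrow> (\<forall>x y. \<phi> (x + y) = \<phi> x + \<phi> y) \<and> (\<forall>c x. \<phi> (sW c x) = c * \<phi> x)"
proof -
  have "vector_space ((*) :: complex \<Rightarrow> complex \<Rightarrow> complex)"
    by unfold_locales (auto simp: algebra_simps)
  thus ?thesis using vector_space_axioms by (simp add: Vector_Spaces.linear_iff)
qed

lemma operator_iff:
  "operator T \<longleftrightarrow> (\<forall>x y. T (x + y) = T x + T y) \<and> (\<forall>c x. T (sW c x) = sW c (T x))"
  using vector_space_axioms by (simp add: Vector_Spaces.linear_iff)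

lemma functional_comp: "functional \<phi> \<Longrightarrow> operator T \<Longrightarrow> functional (\<lambda>v. \<phi> (T v))"
  by (simp add: functional_iff operator_iff)

lemma functional_sum: "functional \<phi> \<Longrightarrow> \<phi> (\<Sum>i\<in>I. f i) = (\<Sum>i\<in>I. \<phi> (f i))"
proof (induction I rule: infinite_finite_induct)
  case (infinite A)
  thus ?case unfolding functional_iff by (metis add_cancel_right_left sum.infinite)
next
  case empty
  thus ?case unfolding functional_iff by (metis add_cancel_right_left sum.empty)
next
  case (insert x F)
  thus ?case by (simp add: functional_iff)
qed

lemma operator_sum: "operator T \<Longrightarrow> T (\<Sum>i\<in>I. f i) = (\<Sum>i\<in>I. T (f i))"
proof (induction I rule: infinite_finite_induct)
  case (infinite A)
  thus ?case unfolding operator_iff by (metis add_cancel_right_left sum.infinite)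
next
  case empty
  thus ?case unfolding operator_iff by (metis add_cancel_right_left sum.empty)
next
  case (insert x F)
  thus ?case by (simp add: operator_iff)
qed

lemma functional_coord: "functional (\<lambda>v. coord v b)"
  by (rule linear_representation[OF independent_Basis span_Basis])

lemma coord_sum: "(\<Sum>b\<in>BW. sW (coord v b) b) = v"
  by (rule sum_representation_eq) (auto simp: independent_Basis span_Basis finite_Basis)

lemma functional_coord_sum: "functional \<phi> \<Longrightarrow> \<phi> v = (\<Sum>b\<in>BW. coord v b * \<phi> b)"
  using functional_sum[of \<phi> "\<lambda>b. sW (coord v b) b" BW] by (simp add: coord_sum functional_iff)

lemma coord_eqI:
  assumes "\<And>b. b \<in> BW \<Longrightarrow> coord u b = coord v b"
  shows "u = v"
proof -
  have "(\<Sum>b\<in>BW. sW (coord u b) b) = (\<Sum>b\<in>BW. sW (coord v b) b)"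
    using assms by (intro sum.cong) simp_all
  thus ?thesis by (simp only: coord_sum)
qed

lemma nrm_nonneg: "nrm v \<ge> 0"
  by (simp add: nrm_def sum_nonneg)

lemma nrm_add: "nrm (u + v) \<le> nrm u + nrm v"
  using functional_coord unfolding functional_iff nrm_def
  by (auto simp: sum.distrib[symmetric] intro!: sum_mono norm_triangle_ineq)

lemma nrm_scale: "nrm (sW c v) = cmod c * nrm v"
  using functional_coord unfolding functional_iff nrm_def
  by (simp add: sum_distrib_left norm_mult)

lemma nrm_zero [simp]: "nrm 0 = 0"
  using nrm_scale[of 0 0] by simp

lemma nrm_sum: "nrm (\<Sum>i\<in>I. f i) \<le> (\<Sum>i\<in>I. nrm (f i))"
  by (induction I rule: infinite_finite_induct) (auto intro: order_trans[OF nrm_add])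

lemma coord_le_nrm: "b \<in> BW \<Longrightarrow> cmod (coord v b) \<le> nrm v"
  unfolding nrm_def by (rule member_le_sum) (auto simp: finite_Basis)

lemma functional_bound:
  assumes "functional \<phi>"
  obtains K where "K \<ge> 0" "\<And>v. cmod (\<phi> v) \<le> K * nrm v"
proof
  show "(\<Sum>b\<in>BW. cmod (\<phi> b)) \<ge> 0" by (simp add: sum_nonneg)
  fix v
  have "cmod (\<phi> v) \<le> (\<Sum>b\<in>BW. cmod (coord v b) * cmod (\<phi> b))"
    unfolding functional_coord_sum[OF assms, of v] by (rule sum_norm_le) (simp add: norm_mult)
  also have "\<dots> \<le> (\<Sum>b\<in>BW. nrm v * cmod (\<phi> b))"
    by (intro sum_mono mult_right_mono coord_le_nrm) auto
  finally show "cmod (\<phi> v) \<le> (\<Sum>b\<in>BW. cmod (\<phi> b)) * nrm v"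
    by (simp add: sum_distrib_left mult.commute)
qed

lemma operator_bound:
  assumes "operator T"
  obtains K where "K \<ge> 0" "\<And>v. nrm (T v) \<le> K * nrm v"
proof
  show "(\<Sum>b\<in>BW. nrm (T b)) \<ge> 0" by (simp add: sum_nonneg nrm_nonneg)
  fix v
  have "T v = (\<Sum>b\<in>BW. sW (coord v b) (T b))"
    using operator_sum[OF assms, of "\<lambda>b. sW (coord v b) b" BW] assms
    by (simp add: coord_sum operator_iff)
  hence "nrm (T v) \<le> (\<Sum>b\<in>BW. cmod (coord v b) * nrm (T b))"
    using nrm_sum[of "\<lambda>b. sW (coord v b) (T b)" BW] by (simp add: nrm_scale)
  also have "\<dots> \<le> (\<Sum>b\<in>BW. nrm v * nrm (T b))"
    by (intro sum_mono mult_right_mono coord_le_nrm nrm_nonneg) auto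
  finally show "nrm (T v) \<le> (\<Sum>b\<in>BW. nrm (T b)) * nrm v"
    by (simp add: sum_distrib_left mult.commute)
qed

lemma operators_bound:
  assumes "finite X" "\<And>x. x \<in> X \<Longrightarrow> operator (T x)"
  obtains M where "M \<ge> 1" "\<And>x v. x \<in> X \<Longrightarrow> nrm (T x v) \<le> M * nrm v"
proof -
  have "\<forall>x\<in>X. \<exists>K\<ge>0. \<forall>v. nrm (T x v) \<le> K * nrm v"
    using assms(2) operator_bound by metis
  then obtain K where K: "\<forall>x\<in>X. K x \<ge> 0 \<and> (\<forall>v. nrm (T x v) \<le> K x * nrm v)" by metis
  show thesis
  proof
    \<comment> \<open>The summand 1 keeps the bound positive even for empty \<open>X\<close>; it is
      later divided by and put under a logarithm.\<close>
    show "1 + (\<Sum>x\<in>X. K x) \<ge> 1" using K by (simp add: sum_nonneg)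
    fix x v assume x: "x \<in> X"
    have "K x \<le> (\<Sum>x\<in>X. K x)" using assms(1) x K by (intro member_le_sum) auto
    hence "K x * nrm v \<le> (1 + (\<Sum>x\<in>X. K x)) * nrm v" by (intro mult_right_mono nrm_nonneg) auto
    thus "nrm (T x v) \<le> (1 + (\<Sum>x\<in>X. K x)) * nrm v" using K x order_trans by blast
  qed
qed

lemma fd_sums_unique: "fd_sums sW a r \<Longrightarrow> fd_sums sW a r' \<Longrightarrow> r = r'"
  unfolding fd_sums_def by (metis (no_types, lifting) coord_eqI functional_coord sums_unique2)

text \<open>The limit is assembled from the limits of the coordinates; any other functional is a
  finite combination of these.\<close>

lemma fd_sums_ex:
  assumes "\<And>\<phi>. functional \<phi> \<Longrightarrow> summable (\<lambda>p. \<phi> (a p))"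
  obtains r where "fd_sums sW a r"
proof
  let ?S = "\<lambda>b. \<Sum>p. coord (a p) b"
  have co: "(\<lambda>p. coord (a p) b) sums ?S b" for b
    using assms[OF functional_coord] by (rule summable_sums)
  show "fd_sums sW a (\<Sum>b\<in>BW. sW (?S b) b)"
    unfolding fd_sums_def
  proof (intro allI impI)
    fix \<phi> :: "'w \<Rightarrow> complex" assume \<phi>: "functional \<phi>"
    have "(\<lambda>p. \<Sum>b\<in>BW. coord (a p) b * \<phi> b) sums (\<Sum>b\<in>BW. ?S b * \<phi> b)"
      by (intro sums_sum sums_mult2 co)
    also have "(\<Sum>b\<in>BW. ?S b * \<phi> b) = \<phi> (\<Sum>b\<in>BW. sW (?S b) b)"
      using \<phi> by (simp add: functional_sum functional_iff)
    finally show "(\<lambda>p. \<phi> (a p)) sums \<phi> (\<Sum>b\<in>BW. sW (?S b) b)"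
      by (simp flip: functional_coord_sum[OF \<phi>])
  qed
qed

lemma functional_summable:
  assumes "functional \<phi>" "summable (\<lambda>p. nrm (a p))"
  shows "summable (\<lambda>p. cmod (\<phi> (a p)))"
proof -
  obtain K where "\<And>v. cmod (\<phi> v) \<le> K * nrm v" using functional_bound[OF assms(1)] by metis
  thus ?thesis
    by (intro summable_comparison_test'[OF summable_mult[OF assms(2), of K]]) auto
qed

lemma fd_sums_ex_nrm:
  assumes "summable (\<lambda>p. nrm (a p))"
  obtains r where "fd_sums sW a r"
  using fd_sums_ex[of a] functional_summable[OF _ assms] summable_norm_cancel by metis

lemma fd_sums_delta: "fd_sums sW (\<lambda>p. if p = 0 then v else 0) v"
  unfolding fd_sums_def
proof (intro allI impI)
  fix \<phi> :: "'w \<Rightarrow> complex" assume "functional \<phi>"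
  hence "\<phi> 0 = 0" unfolding functional_iff by (metis add_cancel_right_left)
  hence "(\<lambda>p :: nat. \<phi> (if p = 0 then v else 0)) = (\<lambda>p. if p = 0 then \<phi> v else 0)" by auto
  thus "(\<lambda>p. \<phi> (if p = 0 then v else 0)) sums \<phi> v"
    using sums_single[of 0 "\<lambda>_. \<phi> v"] by simp
qed

lemma operator_limit:
  assumes A: "\<And>p. operator (A p)" and R: "\<And>v. fd_sums sW (\<lambda>p. A p v) (R v)"
  shows "operator R"
  unfolding operator_iff
proof (intro conjI allI)
  fix u v c
  have "fd_sums sW (\<lambda>p. A p (u + v)) (R u + R v)"
    using R[of u] R[of v] A unfolding fd_sums_def by (simp add: operator_iff functional_iff sums_add)
  thus "R (u + v) = R u + R v" using R fd_sums_unique by blast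
  have "fd_sums sW (\<lambda>p. A p (sW c v)) (sW c (R v))"
    using R[of v] A unfolding fd_sums_def by (simp add: operator_iff functional_iff sums_mult)
  thus "R (sW c v) = sW c (R v)" using R fd_sums_unique by blast
qed

text \<open>The Cauchy product theorem is for scalar series, whereas \<open>A i\<close> acts on a
  vector here. Expanding \<open>B (p - i)\<close> in the basis writes
  \<open>\<phi> (A i (B (p - i)))\<close> as a finite sum of products of scalars, one Cauchy product
  for each basis vector.\<close>

lemma fd_sums_Cauchy:
  assumes A: "\<And>p. operator (A p)" "\<And>v. summable (\<lambda>p. nrm (A p v))" "\<And>v. fd_sums sW (\<lambda>p. A p v) (RA v)"
    and B: "summable (\<lambda>p. nrm (B p))" "fd_sums sW B RB"
  shows "fd_sums sW (\<lambda>p. \<Sum>i\<le>p. A i (B (p - i))) (RA RB)"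
  unfolding fd_sums_def
proof (intro allI impI)
  fix \<phi> :: "'w \<Rightarrow> complex" assume \<phi>: "functional \<phi>"
  have sumA: "(\<lambda>p. \<phi> (A p b)) sums \<phi> (RA b)" for b using A(3) \<phi> unfolding fd_sums_def by blast
  have sumB: "(\<lambda>p. coord (B p) b) sums coord RB b" for b
    using B(2) functional_coord unfolding fd_sums_def by blast
  have "(\<lambda>p. \<Sum>i\<le>p. \<phi> (A i b) * coord (B (p - i)) b) sums (\<phi> (RA b) * coord RB b)" for b
    using Cauchy_product_sums[of "\<lambda>p. \<phi> (A p b)" "\<lambda>p. coord (B p) b"]
      functional_summable[OF \<phi> A(2)] functional_summable[OF functional_coord B(1)]
      sums_unique[OF sumA] sums_unique[OF sumB] by metis
  hence "(\<lambda>p. \<Sum>b\<in>BW. \<Sum>i\<le>p. \<phi> (A i b) * coord (B (p - i)) b) sums (\<Sum>b\<in>BW. \<phi> (RA b) * coord RB b)"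
    by (rule sums_sum)
  also have "(\<lambda>p. \<Sum>b\<in>BW. \<Sum>i\<le>p. \<phi> (A i b) * coord (B (p - i)) b) = (\<lambda>p. \<phi> (\<Sum>i\<le>p. A i (B (p - i))))"
  proof
    fix p
    have "\<phi> (\<Sum>i\<le>p. A i (B (p - i))) = (\<Sum>i\<le>p. \<Sum>b\<in>BW. coord (B (p - i)) b * \<phi> (A i b))"
      unfolding functional_sum[OF \<phi>]
      by (intro sum.cong refl functional_coord_sum functional_comp[OF \<phi> A(1)])
    thus "(\<Sum>b\<in>BW. \<Sum>i\<le>p. \<phi> (A i b) * coord (B (p - i)) b) = \<phi> (\<Sum>i\<le>p. A i (B (p - i)))"
      by (simp add: sum.swap[of _ BW] mult.commute)
  qed
  also have "(\<Sum>b\<in>BW. \<phi> (RA b) * coord RB b) = \<phi> (RA RB)"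
    using functional_coord_sum[OF functional_comp[OF \<phi> operator_limit[OF A(1) A(3)]], of RB]
    by (simp add: mult.commute)
  finally show "(\<lambda>p. \<phi> (\<Sum>i\<le>p. A i (B (p - i)))) sums \<phi> (RA RB)" .
qed

end

text \<open>The sum on the right does not mention \<open>d\<close>: two gradings of one summable
  family with finite fibres give series with the same sum. It serves to compare grading words by
  length and by degree.\<close>

lemma sums_fibres:
  fixes t :: "'b \<Rightarrow> complex" and d :: "'b \<Rightarrow> nat"
  assumes t: "t summable_on X" and fin: "\<And>n. finite {x \<in> X. d x = n}"
  shows "(\<lambda>n. \<Sum>x | x \<in> X \<and> d x = n. t x) sums infsum t X"
proof -
  have "bij_betw snd (SIGMA n:UNIV. {x \<in> X. d x = n}) X"
    by (rule bij_betwI[where g = "\<lambda>x. (d x, x)"]) auto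
  hence "((\<lambda>x. t (snd x)) has_sum infsum t X) (SIGMA n:UNIV. {x \<in> X. d x = n})"
    using has_sum_reindex_bij_betw[of snd _ X t] has_sum_infsum[OF t] by blast
  hence "((\<lambda>n. \<Sum>x | x \<in> X \<and> d x = n. t x) has_sum infsum t X) UNIV"
    by (rule has_sum_Sigma') (use fin in auto)
  thus ?thesis by (rule has_sum_imp_sums)
qed

text \<open>There are \<open>card F ^ m\<close> words of length \<open>m\<close>, so every finite
  partial sum is at most \<open>D * exp (card F * M)\<close>.\<close>

lemma exp_words_summable:
  fixes D M :: real
  assumes F: "finite F" and M: "M \<ge> 0" "D \<ge> 0"
  shows "(\<lambda>w. D * (M ^ length w / fact (length w))) summable_on {w. set w \<subseteq> F}"
proof (rule nonneg_bdd_above_summable_on)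
  let ?g = "\<lambda>w :: 'a list. D * (M ^ length w / fact (length w))"
  let ?L = "\<lambda>m. {w. set w \<subseteq> F \<and> length w = m}"
  let ?x = "of_nat (card F) * M"
  show "bdd_above (sum ?g ` {Y. Y \<subseteq> {w. set w \<subseteq> F} \<and> finite Y})"
  proof (rule bdd_aboveI2)
    fix Y assume "Y \<in> {Y. Y \<subseteq> {w. set w \<subseteq> F} \<and> finite Y}"
    hence Y: "Y \<subseteq> {w. set w \<subseteq> F}" "finite Y" by auto
    then obtain n where n: "\<forall>w\<in>Y. length w < n"
      using finite_nat_set_iff_bounded[of "length ` Y"] by auto
    have fin: "finite (?L m)" for m
      using finite_lists_length_eq[OF F] .
    have "sum ?g Y \<le> sum ?g (\<Union>m<n. ?L m)"
      using Y n fin M by (intro sum_mono2) auto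
    also have "\<dots> = (\<Sum>m<n. sum ?g (?L m))"
      using fin by (intro sum.UNION_disjoint) auto
    also have "\<dots> = (\<Sum>m<n. D * (?x ^ m /\<^sub>R fact m))"
      using F by (intro sum.cong refl)
        (simp add: card_lists_length_eq power_mult_distrib divide_inverse mult_ac)
    also have "\<dots> = D * (\<Sum>m<n. ?x ^ m /\<^sub>R fact m)" by (simp add: sum_distrib_left)
    also have "\<dots> \<le> D * exp ?x"
      unfolding exp_def using M
      by (intro mult_left_mono sum_le_suminf summable_exp_generic) auto
    finally show "sum ?g Y \<le> D * exp ?x" .
  qed
qed (use M in auto)

section \<open>Evaluating group elements\<close>

text \<open>
  The scalar multiplication \<open>s\<close> of the ground field is separate from \<open>sW\<close> so that the real algebra,
  acting through the restriction of \<open>sW\<close>, and its complexification are both instances.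
\<close>

locale fd_lie_eval = fd_complex sW BW + act: lie_eval s scale br \<sigma>
  for sW :: "complex \<Rightarrow> 'w::ab_group_add \<Rightarrow> 'w" and BW :: "'w set"
    and s :: "'k::real_normed_field \<Rightarrow> 'w \<Rightarrow> 'w"
    and scale :: "'k \<Rightarrow> 'a::ab_group_add \<Rightarrow> 'a" and br :: "'a \<Rightarrow> 'a \<Rightarrow> 'a" and \<sigma> :: "'a \<Rightarrow> 'w \<Rightarrow> 'w" +
  assumes nrm_s: "nrm (s c v) = norm c * nrm v"
    and s_sW: "s c (sW a v) = sW a (s c v)"
    and act_operator: "operator (\<sigma> x)"
begin

lemma operator_word: "operator (foldr \<sigma> w)"
  using act_operator by (induction w) (auto simp: operator_iff)

lemma operator_uact: "operator (act.uact f)"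
  unfolding operator_iff
proof (intro conjI allI)
  show "act.uact f (sW c v) = sW c (act.uact f v)" for c v
    using operator_word by (simp add: act.uact_def operator_iff s_sW scale_sum_right)
qed (rule act.uact_vec_add)

lemma word_bound:
  assumes "M \<ge> 0" "\<And>x v. x \<in> X \<Longrightarrow> nrm (\<sigma> x v) \<le> M * nrm v" "set w \<subseteq> X"
  shows "nrm (foldr \<sigma> w v) \<le> M ^ length w * nrm v"
  using assms(3)
proof (induction w)
  case Nil
  thus ?case by simp
next
  case (Cons x w)
  have "nrm (foldr \<sigma> (x # w) v) \<le> M * nrm (foldr \<sigma> w v)" using assms(2) Cons.prems by simp
  also have "\<dots> \<le> M * (M ^ length w * nrm v)" using Cons assms(1) by (intro mult_left_mono) auto
  finally show ?case by (simp add: mult.assoc)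
qed

lemma uact_antipode:
  assumes "f \<in> carrier free_alg"
  shows "act.uact (antipode f) v = (\<Sum>w | f w \<noteq> 0. s ((- 1) ^ length w * f w) (foldr \<sigma> (rev w) v))"
proof -
  have "act.uact (antipode (lin_comb {w. f w \<noteq> 0} f id)) v =
      (\<Sum>w | f w \<noteq> 0. s ((- 1) ^ length w * f w) (foldr \<sigma> (rev w) v))"
    using assms unfolding antipode_lin_comb by (subst act.uact_lin_comb) (simp_all add: free_alg_carrier)
  thus ?thesis by (simp only: lin_comb_self[OF assms, symmetric])
qed

text \<open>Reversal and signs change neither the number of letters of a word nor the absolute
  values of the coefficients, hence the same bound for both actions.\<close>

lemma uact_bound:
  assumes M: "M \<ge> 0" "\<And>x v. x \<in> \<Omega> \<Longrightarrow> nrm (\<sigma> x v) \<le> M * nrm v"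
    and c: "c \<in> carrier free_alg" "\<And>w. c w \<noteq> 0 \<Longrightarrow> length w = p \<and> set w \<subseteq> \<Omega>"
  shows "nrm (act.uact c v) \<le> M ^ p * nrm v * (\<Sum>w | c w \<noteq> 0. norm (c w))"
    and "nrm (act.uact (antipode c) v) \<le> M ^ p * nrm v * (\<Sum>w | c w \<noteq> 0. norm (c w))"
proof -
  have wb: "nrm (foldr \<sigma> w v) \<le> M ^ p * nrm v" "nrm (foldr \<sigma> (rev w) v) \<le> M ^ p * nrm v"
    if "c w \<noteq> 0" for w
    using word_bound[of M \<Omega> w v] word_bound[of M \<Omega> "rev w" v] M c(2)[OF that] by auto
  show "nrm (act.uact c v) \<le> M ^ p * nrm v * (\<Sum>w | c w \<noteq> 0. norm (c w))"
    unfolding act.uact_def sum_distrib_left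
    by (rule order_trans[OF nrm_sum sum_mono])
      (use wb in \<open>auto simp: nrm_s mult.commute intro!: mult_left_mono\<close>)
  show "nrm (act.uact (antipode c) v) \<le> M ^ p * nrm v * (\<Sum>w | c w \<noteq> 0. norm (c w))"
    unfolding uact_antipode[OF c(1)] sum_distrib_left
    by (rule order_trans[OF nrm_sum sum_mono])
      (use wb in \<open>auto simp: nrm_s norm_mult norm_power mult.commute intro!: mult_left_mono\<close>)
qed

lemma uact_class_eq:
  assumes "f \<in> carrier free_alg" "g \<in> carrier free_alg" "uea_class scale br f = uea_class scale br g"
  shows "act.uact f v = act.uact g v" "act.uact (antipode f) v = act.uact (antipode g) v"
  using act.uact_class[OF assms(2), of f] act.uact_antipode_class[OF assms(2), of f]
    uea_class_self[OF assms(1), of scale br] assms(3) by auto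

text \<open>The chosen \<open>f p\<close> need not be close to optimal. Its action depends only on
  the class \<open>z p\<close>, so the bound coming from every representation \<open>c\<close> of
  \<open>z p\<close> applies to it, and passing to the infimum brings in
  \<open>unorm\<close>.\<close>

lemma U_circ_rep:
  assumes fin: "finite \<Omega>"
    and letter: "\<And>k x. x \<in> gr k \<Longrightarrow> word_rep scale br \<Omega> k (word_monom 1 [x])"
    and z: "z \<in> U_circ scale br gr \<Omega>"
  obtains f where "\<And>p. f p \<in> carrier free_alg" "\<And>p. z p = uea_class scale br (f p)"
    "\<And>p w. f p w \<noteq> 0 \<Longrightarrow> set w \<subseteq> \<Omega>"
    "\<And>v. summable (\<lambda>p. nrm (act.uact (f p) v))" "\<And>v. summable (\<lambda>p. nrm (act.uact (antipode (f p)) v))"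
proof -
  have "z p \<in> uea_grade scale br gr p" for p
    using z by (simp add: U_circ_def useries_def)
  hence "\<exists>c. c \<in> carrier free_alg \<and> (\<forall>w. c w \<noteq> 0 \<longrightarrow> length w = p \<and> set w \<subseteq> \<Omega>) \<and>
      z p = uea_class scale br c" for p
    using uea_grade_word_rep[OF letter, of gr "z p" p] by metis
  then obtain f where f: "\<And>p. f p \<in> carrier free_alg"
    "\<And>p w. f p w \<noteq> 0 \<Longrightarrow> length w = p \<and> set w \<subseteq> \<Omega>" "\<And>p. z p = uea_class scale br (f p)"
    by metis
  obtain M where M: "M \<ge> 1" "\<And>x v. x \<in> \<Omega> \<Longrightarrow> nrm (\<sigma> x v) \<le> M * nrm v"
    by (rule operators_bound[OF fin, of \<sigma>]) (use act_operator in auto)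
  \<comment> \<open>With \<open>C = ln (2 * M)\<close> the norms are at most
    \<open>K / (2 * M) ^ p\<close>; against the growth \<open>M ^ p\<close> of words of length
    \<open>p\<close> this leaves a geometric series of ratio 1/2.\<close>
  obtain K where K: "\<And>p. unorm scale br \<Omega> p (z p) * exp (ln (2 * M) * real p) \<le> K"
    using z by (auto simp: U_circ_def bdd_above_def)
  \<comment> \<open>Stated for any map \<open>e\<close> bounded through all representations of
    \<open>z p\<close>, to serve both the action and its antipode.\<close>
  have summ: "summable (\<lambda>p. nrm (e (f p)))"
    if e: "\<And>p c. c \<in> carrier free_alg \<Longrightarrow> (\<And>w. c w \<noteq> 0 \<Longrightarrow> length w = p \<and> set w \<subseteq> \<Omega>) \<Longrightarrow>
        z p = uea_class scale br c \<Longrightarrow> nrm (e (f p)) \<le> M ^ p * nrm v * (\<Sum>w | c w \<noteq> 0. norm (c w))"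
    for e v
  proof -
    have "nrm (e (f p)) \<le> M ^ p * nrm v * unorm scale br \<Omega> p (z p)" for p
    \<comment> \<open>To become a lower bound for the infimum, the estimate is divided by
      \<open>M ^ p * nrm v\<close>; norm zero is therefore treated apart.\<close>
    proof (cases "nrm v = 0")
      case True
      thus ?thesis using e[of "f p" p] f by simp
    next
      case False
      hence "nrm v > 0" using nrm_nonneg[of v] by linarith
      hence pos: "M ^ p * nrm v > 0" using M(1) by simp
      have "nrm (e (f p)) / (M ^ p * nrm v) \<le> unorm scale br \<Omega> p (z p)"
        unfolding unorm_def
      proof (rule cInf_greatest)
        show "{\<Sum>w | c w \<noteq> 0. norm (c w) | c. c \<in> carrier free_alg \<and>
            (\<forall>w. c w \<noteq> 0 \<longrightarrow> length w = p \<and> set w \<subseteq> \<Omega>) \<and> z p = uea_class scale br c} \<noteq> {}"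
          using f by blast
      qed (use e pos in \<open>auto simp: divide_le_eq mult.commute\<close>)
      thus ?thesis using pos by (simp add: divide_le_eq mult.commute)
    qed
    moreover have "M ^ p * nrm v * unorm scale br \<Omega> p (z p) \<le> nrm v * K * (1 / 2) ^ p" for p
    proof -
      have "exp (ln (2 * M) * real p) = (2 * M) ^ p"
        using M(1) exp_of_nat_mult[of p "ln (2 * M)"] by (simp add: mult.commute)
      hence "unorm scale br \<Omega> p (z p) * (2 ^ p * M ^ p) \<le> K"
        using K[of p] by (simp add: power_mult_distrib)
      hence "nrm v * (1 / 2) ^ p * (unorm scale br \<Omega> p (z p) * (2 ^ p * M ^ p)) \<le> nrm v * (1 / 2) ^ p * K"
        by (intro mult_left_mono) (simp_all add: nrm_nonneg)
      thus ?thesis by (simp add: field_simps)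
    qed
    ultimately have "norm (nrm (e (f p))) \<le> nrm v * K * (1 / 2) ^ p" for p
      using order_trans nrm_nonneg by fastforce
    thus ?thesis
      by (intro summable_comparison_test'[OF summable_mult[OF summable_geometric]]) auto
  qed
  have M0: "M \<ge> 0" using M(1) by simp
  show thesis
  proof
    show "summable (\<lambda>p. nrm (act.uact (f p) v))" for v
    proof (rule summ)
      fix p c assume c: "c \<in> carrier free_alg" "\<And>w. c w \<noteq> 0 \<Longrightarrow> length w = p \<and> set w \<subseteq> \<Omega>"
        "z p = uea_class scale br c"
      show "nrm (act.uact (f p) v) \<le> M ^ p * nrm v * (\<Sum>w | c w \<noteq> 0. norm (c w))"
        using uact_bound(1)[OF M0 M(2) c(1,2)] uact_class_eq(1)[OF f(1) c(1)] f(3) c(3) by metis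
    qed
    show "summable (\<lambda>p. nrm (act.uact (antipode (f p)) v))" for v
    proof (rule summ)
      fix p c assume c: "c \<in> carrier free_alg" "\<And>w. c w \<noteq> 0 \<Longrightarrow> length w = p \<and> set w \<subseteq> \<Omega>"
        "z p = uea_class scale br c"
      show "nrm (act.uact (antipode (f p)) v) \<le> M ^ p * nrm v * (\<Sum>w | c w \<noteq> 0. norm (c w))"
        using uact_bound(2)[OF M0 M(2) c(1,2)] uact_class_eq(2)[OF f(1) c(1)] f(3) c(3) by metis
    qed
  qed (use f in auto)
qed

text \<open>Action and antipode see only classes, so \<open>f p\<close> may be exchanged for the
  explicit words of the exponential. The factors then have parameters 1 and - 1, which add up to 0
  in either order.\<close>

lemma G_bar_inverse:
  assumes z: "z \<in> G_bar scale br gr" and gr0: "gr 0 = {0}"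
    and f: "\<And>p. f p \<in> carrier free_alg" "\<And>p. z p = uea_class scale br (f p)"
  shows "(\<Sum>i\<le>p. act.uact (f i) (act.uact (antipode (f (p - i))) v)) = (if p = 0 then v else 0)"
    and "(\<Sum>i\<le>p. act.uact (antipode (f i)) (act.uact (f (p - i)) v)) = (if p = 0 then v else 0)"
proof -
  obtain \<xi> where \<xi>: "\<forall>k. \<xi> k \<in> gr k" "z = useries_exp scale br gr (lie_series scale br \<xi>)"
    using z by (auto simp: G_bar_def lie_completion_def)
  have \<xi>0: "\<xi> 0 = 0" using \<xi>(1) gr0 by auto
  let ?E = "\<lambda>p. lin_comb {w. length w \<le> p \<and> sum_list w = p} (\<lambda>w. 1 / fact (length w)) (map \<xi>)"
  have E: "?E p \<in> carrier free_alg" "uea_class scale br (f p) = uea_class scale br (?E p)" for p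
    using f(2)[of p] \<xi>(2) useries_exp_rep[of scale br gr \<xi> p]
    by (simp_all add: lin_comb_carrier finite_words_sum_le)
  have "act.uact (f p) v = act.exp_component \<xi> 1 p v"
    "act.uact (antipode (f p)) v = act.exp_component \<xi> (- 1) p v" for p v
    unfolding uact_class_eq[OF f(1) E(1) E(2)]
    by (rule act.uact_exp_rep[where \<xi> = \<xi>, OF \<xi>0]
        act.uact_antipode_exp_rep[where \<xi> = \<xi>, OF \<xi>0])+
  thus "(\<Sum>i\<le>p. act.uact (f i) (act.uact (antipode (f (p - i))) v)) = (if p = 0 then v else 0)"
    "(\<Sum>i\<le>p. act.uact (antipode (f i)) (act.uact (f (p - i)) v)) = (if p = 0 then v else 0)"
    by (simp_all add: act.exp_component_conv act.exp_component_0)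
qed

lemma G_circ_rep:
  assumes fin: "finite \<Omega>" and gr0: "gr 0 = {0}"
    and letter: "\<And>k x. x \<in> gr k \<Longrightarrow> word_rep scale br \<Omega> k (word_monom 1 [x])"
    and z: "z \<in> carrier (G_circ scale br gr \<Omega>)"
  obtains f R R' where "\<And>p. f p \<in> carrier free_alg" "\<And>p. z p = uea_class scale br (f p)"
    "\<And>p w. f p w \<noteq> 0 \<Longrightarrow> set w \<subseteq> \<Omega>" "\<And>v. summable (\<lambda>p. nrm (act.uact (f p) v))"
    "\<And>v. fd_sums sW (\<lambda>p. act.uact (f p) v) (R v)"
    "\<And>v. fd_sums sW (\<lambda>p. act.uact (antipode (f p)) v) (R' v)"
    "operator R" "\<And>v. R (R' v) = v" "\<And>v. R' (R v) = v"
proof -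
  have zU: "z \<in> U_circ scale br gr \<Omega>" and zG: "z \<in> G_bar scale br gr"
    using z by (auto simp: G_circ_def)
  obtain f where f: "\<And>p. f p \<in> carrier free_alg" "\<And>p. z p = uea_class scale br (f p)"
    "\<And>p w. f p w \<noteq> 0 \<Longrightarrow> set w \<subseteq> \<Omega>"
    "\<And>v. summable (\<lambda>p. nrm (act.uact (f p) v))" "\<And>v. summable (\<lambda>p. nrm (act.uact (antipode (f p)) v))"
    by (rule U_circ_rep[OF fin letter zU]) (assumption, rule that)
  have "\<exists>r. fd_sums sW (\<lambda>p. act.uact (f p) v) r" for v
    using fd_sums_ex_nrm[OF f(4)[of v]] by blast
  then obtain R where R: "\<And>v. fd_sums sW (\<lambda>p. act.uact (f p) v) (R v)" by metis
  have "\<exists>r. fd_sums sW (\<lambda>p. act.uact (antipode (f p)) v) r" for v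
    using fd_sums_ex_nrm[OF f(5)[of v]] by blast
  then obtain R' where R': "\<And>v. fd_sums sW (\<lambda>p. act.uact (antipode (f p)) v) (R' v)" by metis
  have inv: "R (R' v) = v" for v
  proof (rule fd_sums_unique)
    show "fd_sums sW (\<lambda>p. if p = 0 then v else 0) (R (R' v))"
      using fd_sums_Cauchy[OF operator_uact f(4) R f(5) R'] G_bar_inverse(1)[OF zG gr0 f(1,2)] by simp
  qed (rule fd_sums_delta)
  have inv': "R' (R v) = v" for v
  proof (rule fd_sums_unique)
    show "fd_sums sW (\<lambda>p. if p = 0 then v else 0) (R' (R v))"
      using fd_sums_Cauchy[OF operator_uact f(5) R' f(4) R] G_bar_inverse(2)[OF zG gr0 f(1,2)] by simp
  qed (rule fd_sums_delta)
  show thesis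
    using that[OF f(1,2,3,4) R R' operator_limit[OF operator_uact R] inv inv'] .
qed

section \<open>Exponentials of finite sums of homogeneous elements\<close>

lemma act_power_words:
  assumes "finite F"
  shows "(\<sigma> (\<Sum>k\<in>F. \<xi> k) ^^ m) v = (\<Sum>w | set w \<subseteq> F \<and> length w = m. foldr \<sigma> (map \<xi> w) v)"
proof (induction m)
  case 0
  have "{w. set w \<subseteq> F \<and> length w = 0} = {[]}" by auto
  thus ?case by simp
next
  case (Suc m)
  have "(\<sigma> (\<Sum>k\<in>F. \<xi> k) ^^ Suc m) v =
      (\<Sum>k\<in>F. \<Sum>w | set w \<subseteq> F \<and> length w = m. foldr \<sigma> (map \<xi> (k # w)) v)"
    by (simp add: Suc.IH act.act_sum operator_sum[OF act_operator]) (rule sum.swap)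
  also have "\<dots> = (\<Sum>(w, k)\<in>{w. set w \<subseteq> F \<and> length w = m} \<times> F. foldr \<sigma> (map \<xi> (k # w)) v)"
    unfolding sum.cartesian_product[symmetric] by (rule sum.swap)
  also have "\<dots> = (\<Sum>w | set w \<subseteq> F \<and> length w = Suc m. foldr \<sigma> (map \<xi> w) v)"
    unfolding lists_length_Suc_eq
    by (subst sum.reindex) (auto simp: inj_on_def intro!: sum.cong)
  finally show ?case .
qed

text \<open>Both series regroup the same family \<open>t\<close>, indexed by words over the finite
  support of \<open>\<xi>\<close>: by \<open>sum_list\<close> it gives the components of the
  exponential, by \<open>length\<close> the powers of the operator. Absolute summability makes the
  sums agree.\<close>

lemma exp_finite_sums:
  assumes \<xi>0: "\<xi> 0 = 0" and fin: "finite {k. \<xi> k \<noteq> 0}"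
  obtains r where "fd_sums sW (\<lambda>p. act.exp_component \<xi> 1 p v) r"
    "fd_sums sW (\<lambda>m. s (1 / fact m) ((\<sigma> (\<Sum>k | \<xi> k \<noteq> 0. \<xi> k) ^^ m) v)) r"
proof -
  let ?F = "{k. \<xi> k \<noteq> 0}" and ?X = "{w. set w \<subseteq> {k. \<xi> k \<noteq> 0}}"
  define t where "t w = s (1 / fact (length w)) (foldr \<sigma> (map \<xi> w) v)" for w
  obtain M where M: "M \<ge> 1" "\<And>x v. x \<in> \<xi> ` ?F \<Longrightarrow> nrm (\<sigma> x v) \<le> M * nrm v"
    by (rule operators_bound[of "\<xi> ` ?F" \<sigma>]) (use fin act_operator in auto)
  have summ: "(\<lambda>w. \<phi> (t w)) summable_on ?X" if \<phi>: "functional \<phi>" for \<phi>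
  proof -
    obtain K where K: "K \<ge> 0" "\<And>v. cmod (\<phi> v) \<le> K * nrm v" using functional_bound[OF \<phi>] by metis
    have "(\<lambda>w. (K * nrm v) * (M ^ length w / fact (length w))) summable_on ?X"
      using fin M(1) K(1) nrm_nonneg by (intro exp_words_summable) auto
    hence "(\<lambda>w. norm (\<phi> (t w))) summable_on ?X"
    proof (rule Infinite_Sum.abs_summable_on_comparison_test')
      fix w assume "w \<in> ?X"
      hence "nrm (foldr \<sigma> (map \<xi> w) v) \<le> M ^ length w * nrm v"
        using word_bound[of M "\<xi> ` ?F" "map \<xi> w" v] M by auto
      hence "nrm (t w) \<le> M ^ length w * nrm v / fact (length w)"
        by (simp add: t_def nrm_s norm_divide divide_right_mono)
      hence "K * nrm (t w) \<le> K * (M ^ length w * nrm v / fact (length w))"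
        using K(1) by (rule mult_left_mono)
      thus "norm (\<phi> (t w)) \<le> (K * nrm v) * (M ^ length w / fact (length w))"
        using K(2)[of "t w"] by (simp add: mult_ac)
    qed
    thus ?thesis by (rule abs_summable_summable)
  qed
  have len: "(\<Sum>w | w \<in> ?X \<and> length w = m. t w) =
      s (1 / fact m) ((\<sigma> (\<Sum>k | \<xi> k \<noteq> 0. \<xi> k) ^^ m) v)" for m
    unfolding act_power_words[OF fin] act.scale_sum_right by (intro sum.cong) (auto simp: t_def)
  \<comment> \<open>Compositions with a part outside the support of \<open>\<xi>\<close> contribute
    zero.\<close>
  have sl: "(\<Sum>w | w \<in> ?X \<and> sum_list w = p. t w) = act.exp_component \<xi> 1 p v" for p
  proof -
    have "{w. w \<in> ?X \<and> sum_list w = p} \<subseteq> compositions p"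
      using \<xi>0 by (auto simp: compositions_def)
    moreover have "t w = 0" if "w \<in> compositions p - {w. w \<in> ?X \<and> sum_list w = p}" for w
    proof -
      have "0 \<in> set (map \<xi> w)" using that by (force simp: compositions_def)
      thus ?thesis using act.word_zero_letter by (simp add: t_def)
    qed
    ultimately have "(\<Sum>w | w \<in> ?X \<and> sum_list w = p. t w) = (\<Sum>w\<in>compositions p. t w)"
      by (intro sum.mono_neutral_left finite_compositions) auto
    thus ?thesis by (simp add: act.exp_component_def t_def)
  qed
  have sums1: "(\<lambda>p. \<phi> (act.exp_component \<xi> 1 p v)) sums infsum (\<lambda>w. \<phi> (t w)) ?X" if \<phi>: "functional \<phi>" for \<phi>
  proof -
    \<comment> \<open>Fibres of the degree are finite because \<open>\<xi> 0 = 0\<close> keeps the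
      letter 0 out of the support; otherwise words could be padded with zeros.\<close>
    have "finite {w \<in> ?X. sum_list w = p}" for p
      by (rule finite_subset[OF _ finite_compositions[of p]]) (use \<xi>0 in \<open>auto simp: compositions_def\<close>)
    from sums_fibres[OF summ[OF \<phi>] this] show ?thesis
      by (simp only: functional_sum[OF \<phi>, symmetric] sl)
  qed
  have sums2: "(\<lambda>m. \<phi> (s (1 / fact m) ((\<sigma> (\<Sum>k | \<xi> k \<noteq> 0. \<xi> k) ^^ m) v))) sums infsum (\<lambda>w. \<phi> (t w)) ?X"
    if \<phi>: "functional \<phi>" for \<phi>
  proof -
    have "finite {w \<in> ?X. length w = m}" for m
      using finite_lists_length_eq[OF fin, of m] by simp
    from sums_fibres[OF summ[OF \<phi>] this] show ?thesis
      by (simp only: functional_sum[OF \<phi>, symmetric] len)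
  qed
  obtain r where r: "fd_sums sW (\<lambda>p. act.exp_component \<xi> 1 p v) r"
    by (rule fd_sums_ex[OF sums_summable[OF sums1]])
  moreover have "fd_sums sW (\<lambda>m. s (1 / fact m) ((\<sigma> (\<Sum>k | \<xi> k \<noteq> 0. \<xi> k) ^^ m) v)) r"
    unfolding fd_sums_def
  proof (intro allI impI)
    fix \<phi> :: "'w \<Rightarrow> complex" assume \<phi>: "functional \<phi>"
    have "(\<lambda>p. \<phi> (act.exp_component \<xi> 1 p v)) sums \<phi> r" using r \<phi> unfolding fd_sums_def by blast
    with sums1[OF \<phi>] have "infsum (\<lambda>w. \<phi> (t w)) ?X = \<phi> r" by (rule sums_unique2)
    with sums2[OF \<phi>] show "(\<lambda>m. \<phi> (s (1 / fact m) ((\<sigma> (\<Sum>k | \<xi> k \<noteq> 0. \<xi> k) ^^ m) v))) sums \<phi> r"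
      by simp
  qed
  ultimately show thesis by (rule that)
qed

end

section \<open>Homogeneous letters as words in the generators, real and complex\<close>

lemma graded_letter_word_rep:
  assumes gla: "graded_lie_algebra scaleR br gr" and gen: "span X = gr 1" and x: "x \<in> gr k"
  shows "word_rep scaleR br X k (word_monom 1 [x])"
proof -
  interpret graded_lie_algebra scaleR br gr by (rule gla)
  show ?thesis using x
  proof (rule graded_induct)
    fix x assume "x \<in> gr 1"
    hence "x \<in> Real_Vector_Spaces.span X" using gen by simp
    thus "word_rep scaleR br X 1 (word_monom 1 [x])"
      by (induction rule: Real_Vector_Spaces.span_induct_alt)
        (auto intro: word_rep_letter_zero word_rep_letter_add word_rep_letter_scale
          word_rep_letter_gen[simplified])
  qed (auto intro: word_rep_letter_zero word_rep_letter_add word_rep_letter_scale word_rep_letter_bracket)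
qed

text \<open>The induction runs over the real algebra, with letters \<open>(x, 0)\<close> standing
  for real elements, so generation in degree 1 is invoked only there. The imaginary unit enters
  once, through \<open>x = (a, 0) + cscale \<i> (b, 0)\<close>.\<close>

lemma complex_graded_letter_word_rep:
  assumes gla: "graded_lie_algebra scaleR br gr" and gen: "span X = gr 1" and x: "x \<in> cgr gr k"
  shows "word_rep cscale (cbr br) ((\<lambda>x. (x, 0)) ` X) k (word_monom 1 [x])"
proof -
  interpret graded_lie_algebra scaleR br gr by (rule gla)
  have br0: "br x 0 = 0" "br 0 x = 0" for x
    using br_scale_right[of x 0 0] br_scale_left[of 0 0 x] by auto
  let ?P = "\<lambda>k x. word_rep cscale (cbr br) ((\<lambda>x. (x, 0)) ` X) k (word_monom 1 [(x, 0)])"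
  have P_zero: "?P k 0" for k
    using word_rep_letter_zero[of cscale "cbr br" _ k] by (simp add: zero_prod_def)
  have P_add: "?P k (x + y)" if "?P k x" "?P k y" for k x y
    using word_rep_letter_add[OF that] by simp
  have P_scale: "?P k (c *\<^sub>R x)" if "?P k x" for k c x
    using word_rep_letter_scale[OF that, of "of_real c"] by (simp add: cscale_def)
  have real: "?P k x" if "x \<in> gr k" for k x
    using that
  proof (rule graded_induct)
    show "?P (k + m) (br x y)" if "?P k x" "?P m y" for k m x y
      using word_rep_letter_bracket[OF that] by (simp add: cbr_def br0)
    fix x assume "x \<in> gr 1"
    hence "x \<in> Real_Vector_Spaces.span X" using gen by simp
    thus "?P 1 x"
    proof (induction rule: Real_Vector_Spaces.span_induct_alt)
      case base
      show ?case by (rule P_zero)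
    next
      case (step c x y)
      from step(1) have "?P 1 x" by (intro word_rep_letter_gen) auto
      thus ?case using step(2) by (intro P_add P_scale)
    qed
  qed (auto intro: P_zero P_add P_scale)
  obtain a b where ab: "x = (a, b)" "a \<in> gr k" "b \<in> gr k" using x by (auto simp: cgr_def)
  have "x = (a, 0) + cscale \<i> (b, 0)" by (simp add: ab cscale_def)
  thus ?thesis
    using word_rep_letter_add[OF real[OF ab(2)] word_rep_letter_scale[OF real[OF ab(3)]]] by metis
qed

section \<open>Real series inside complex ones, and Hermitian forms\<close>

lemma free_complexify_lin_comb:
  assumes "f \<in> carrier free_alg"
  shows "free_complexify f = lin_comb {w. f w \<noteq> 0} (\<lambda>w. of_real (f w)) (map (\<lambda>x. (x, 0)))"
proof
  fix w :: "('a \<times> 'a) list"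
  \<comment> \<open>The embedding of real words is injective, so at most one term of the combination
    hits \<open>w\<close>.\<close>
  have *: "w = map (\<lambda>x. (x, 0)) u \<longleftrightarrow> (\<forall>x\<in>set w. snd x = 0) \<and> u = map fst w" for u
    by (induction w arbitrary: u) (auto simp: Cons_eq_map_conv)
  show "free_complexify f w = lin_comb {w. f w \<noteq> 0} (\<lambda>w. of_real (f w)) (map (\<lambda>x. (x, 0))) w"
  proof (cases "\<forall>x\<in>set w. snd x = 0")
    case True
    thus ?thesis
      using assms by (simp add: free_complexify_def lin_comb_def word_monom_def * free_alg_carrier)
  next
    case False
    show ?thesis
      unfolding free_complexify_def lin_comb_def word_monom_def *
      by (simp only: False if_False simp_thms sum.neutral_const)
  qed
qed

lemma hermitian_innerD:
  assumes "hermitian_inner sW h"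
  shows "h (u + v) w = h u w + h v w" "h (sW c u) v = c * h u v" "h v u = cnj (h u v)"
  by (rule assms[unfolded hermitian_inner_def, THEN conjunct1, rule_format]
      assms[unfolded hermitian_inner_def, THEN conjunct2, THEN conjunct1, rule_format]
      assms[unfolded hermitian_inner_def, THEN conjunct2, THEN conjunct2, THEN conjunct1, rule_format])+

text \<open>\<open>fd_sums\<close> tests with linear functionals, but \<open>h\<close> is linear
  only in its first argument. The limit in the second argument is therefore taken after conjugation,
  and the adjoint series at \<open>R v\<close> sums to \<open>R' (R v) = v\<close>.\<close>

lemma hermitian_limit_unitary:
  assumes fd: "fd_complex sW BW" and herm: "hermitian_inner sW h"
    and R: "\<And>v. fd_sums sW (\<lambda>p. A p v) (R v)" and R': "\<And>v. fd_sums sW (\<lambda>p. A' p v) (R' v)"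
    and adj: "\<And>p u v. h (A p u) v = h u (A' p v)" and inv: "\<And>v. R' (R v) = v"
  shows "h (R u) (R v) = h u v"
proof -
  interpret fd_complex sW BW by (rule fd)
  have fnl: "functional (\<lambda>x. h x y)" for y
    using hermitian_innerD(1,2)[OF herm] by (simp add: functional_iff)
  note cnj = hermitian_innerD(3)[OF herm]
  have "(\<lambda>p. h (A p u) (R v)) sums h (R u) (R v)"
    using R[of u] fnl unfolding fd_sums_def by blast
  moreover have "(\<lambda>p. cnj (h (A' p (R v)) u)) sums cnj (h (R' (R v)) u)"
    using R'[of "R v"] fnl unfolding fd_sums_def sums_cnj by blast
  hence "(\<lambda>p. h (A p u) (R v)) sums h u v"
    by (simp only: adj inv cnj[symmetric])
  ultimately show ?thesis by (rule sums_unique2)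
qed

theorem theorem4p8:
  fixes br :: "'g::real_vector \<Rightarrow> 'g \<Rightarrow> 'g"
    and gr :: "nat \<Rightarrow> 'g set"
    and \<omega> :: "nat \<Rightarrow> 'g" and n :: nat
    and sW :: "complex \<Rightarrow> 'w::ab_group_add \<Rightarrow> 'w" and BW :: "'w set"
    and \<rho> :: "'g \<Rightarrow> 'w \<Rightarrow> 'w"
  assumes "graded_lie_algebra scaleR br gr"
    and "inj_on \<omega> {1..n}" and "independent (\<omega> ` {1..n})" and "span (\<omega> ` {1..n}) = gr 1"
    and "finite_dimensional_vector_space sW BW"
    and "lie_rep sW br \<rho>"
  shows "\<exists>R.
    R \<in> hom (G_circ cscale (cbr br) (cgr gr) ((\<lambda>j. (\<omega> j, 0)) ` {1..n})) (GL sW) \<and>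
    integrates sW br gr ((\<lambda>j. (\<omega> j, 0)) ` {1..n}) \<rho> R \<and>
    (\<forall>h. hermitian_inner sW h \<and> (\<forall>j\<in>{1..n}. anti_selfadjoint h (\<rho> (\<omega> j))) \<longrightarrow>
      (\<forall>z \<in> carrier (G_circ scaleR br gr (\<omega> ` {1..n})).
        unitary_op sW h (R (series_complexify br z))))"
proof -
  let ?\<sigma> = "complexify_rep sW \<rho>" and ?\<Omega> = "\<omega> ` {1..n}" and ?\<Omega>C = "(\<lambda>j. (\<omega> j, 0)) ` {1..n}"
  let ?s = "\<lambda>r. sW (complex_of_real r)"
  interpret graded_lie_algebra scaleR br gr by (rule assms(1))
  interpret W: fd_complex sW BW by (simp add: fd_complex_def assms(5))
  note rep = assms(6)[unfolded lie_rep_def]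
  have op: "W.operator (\<rho> x)" for x using rep by blast
  have \<rho>: "\<rho> x (u + v) = \<rho> x u + \<rho> x v" "\<rho> x (sW c v) = sW c (\<rho> x v)"
    "\<rho> (x + y) v = \<rho> x v + \<rho> y v" "\<rho> (r *\<^sub>R x) v = ?s r (\<rho> x v)"
    "\<rho> (br x y) v = \<rho> x (\<rho> y v) - \<rho> y (\<rho> x v)" for x y u v c r
    using op rep unfolding W.operator_iff by blast+
  have \<rho>_diff: "\<rho> (x - y) v = \<rho> x v - \<rho> y v" for x y v
    using \<rho>(3)[of "x - y" y v] by simp
  have \<rho>0: "\<rho> 0 v = 0" for v using \<rho>(3)[of 0 0 v] by simp
  have sW_i: "sW \<i> (sW \<i> v) = - v" for v by (simp add: W.scale_minus_left)
  \<comment> \<open>\<open>cscale\<close> is written through real and imaginary parts, so the scalar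
    acting on \<open>W\<close> is split in the same way.\<close>
  have sW_split: "sW c v = ?s (Re c) v + sW \<i> (?s (Im c) v)" for c v
    by (subst complex_eq[of c]) (simp add: W.scale_left_distrib)

  interpret R: fd_lie_eval sW BW ?s scaleR br \<rho>
    by unfold_locales
      (auto simp: \<rho> op W.nrm_scale W.scale_left_distrib W.scale_right_distrib mult.commute)
  interpret C: fd_lie_eval sW BW sW cscale "cbr br" ?\<sigma>
  proof (intro fd_lie_eval.intro W.fd_complex_axioms lie_eval.intro lie_eval_axioms.intro
      fd_lie_eval_axioms.intro W.vector_space_axioms)
    fix x y :: "'g \<times> 'g" and u v c a
    show "?\<sigma> x (u + v) = ?\<sigma> x u + ?\<sigma> x v" "?\<sigma> x (sW c v) = sW c (?\<sigma> x v)"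
      "?\<sigma> (x + y) v = ?\<sigma> x v + ?\<sigma> y v"
      by (simp_all add: complexify_rep_def \<rho> W.scale_right_distrib W.scale_left_commute mult.commute)
    show "W.operator (?\<sigma> x)"
      by (simp add: W.operator_iff complexify_rep_def \<rho> W.scale_right_distrib W.scale_left_commute mult.commute)
    show "?\<sigma> (cscale c x) v = sW c (?\<sigma> x v)"
      unfolding complexify_rep_def cscale_def fst_conv snd_conv \<rho> \<rho>_diff
        sW_split[of c "\<rho> (fst x) v + sW \<i> (\<rho> (snd x) v)"]
      by (simp add: W.scale_right_distrib W.scale_right_diff_distrib mult.commute sW_i)
    show "?\<sigma> (cbr br x y) v = ?\<sigma> x (?\<sigma> y v) - ?\<sigma> y (?\<sigma> x v)"
      unfolding complexify_rep_def cbr_def fst_conv snd_conv \<rho> \<rho>_diff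
      by (simp add: W.scale_right_distrib W.scale_right_diff_distrib)
    show "W.nrm (sW c v) = norm c * W.nrm v" by (rule W.nrm_scale)
    show "sW c (sW a v) = sW a (sW c v)" by (simp add: mult.commute)
  qed

  have letterR: "\<And>k x. x \<in> gr k \<Longrightarrow> word_rep scaleR br ?\<Omega> k (word_monom 1 [x])"
    by (rule graded_letter_word_rep[OF assms(1,4)])
  have letterC: "\<And>k x. x \<in> cgr gr k \<Longrightarrow> word_rep cscale (cbr br) ?\<Omega>C k (word_monom 1 [x])"
    using complex_graded_letter_word_rep[OF assms(1,4)] by (simp add: image_image)
  have gr0C: "cgr gr 0 = {0}" by (auto simp: cgr_def gr_zero zero_prod_def)

  have free_eval_uact: "free_eval sW ?\<sigma> = C.act.uact"
    by (intro ext) (simp add: free_eval_def C.act.uact_def)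

  \<comment> \<open>Each \<open>z p\<close> is a coset, hence the inner choice of a representative;
    the outer one names the limit. \<open>R\<close> is total, and \<open>R_eqI\<close> evaluates it
    wherever all representatives act alike and the series converges. Products and exponentials can
    thus be evaluated without first placing them in the group.\<close>
  define R where "R z v = (SOME r. fd_sums sW (\<lambda>p. C.act.uact (SOME f. f \<in> z p) v) r)" for z v
  have R_eqI: "R z v = r"
    if "\<And>p f. f \<in> z p \<Longrightarrow> C.act.uact f v = a p" "\<And>p. z p \<noteq> {}" "fd_sums sW a r" for z v a r
  proof -
    have "C.act.uact (SOME f. f \<in> z p) v = a p" for p
      using that(1,2) some_in_eq by metis
    hence "fd_sums sW (\<lambda>p. C.act.uact (SOME f. f \<in> z p) v) r" using that(3) by simp
    hence "fd_sums sW (\<lambda>p. C.act.uact (SOME f. f \<in> z p) v) (R z v)"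
      unfolding R_def by (rule someI)
    thus ?thesis using W.fd_sums_unique \<open>fd_sums sW (\<lambda>p. C.act.uact (SOME f. f \<in> z p) v) r\<close> by blast
  qed
  have R_rep: "R z v = r"
    if "\<And>p. f p \<in> carrier free_alg" "\<And>p. z p = uea_class cscale (cbr br) (f p)"
      "fd_sums sW (\<lambda>p. C.act.uact (f p) v) r" for z v f r
  proof (rule R_eqI[OF _ _ that(3)])
    show "C.act.uact g v = C.act.uact (f p) v" if "g \<in> z p" for g p
      using C.act.uact_class[OF \<open>f p \<in> carrier free_alg\<close>] that \<open>z p = _\<close> by blast
    show "z p \<noteq> {}" for p
      using uea_class_self[OF that(1)] that(2) by blast
  qed
  have G: "\<exists>f T'. (\<forall>p. f p \<in> carrier free_alg) \<and> (\<forall>p. z p = uea_class cscale (cbr br) (f p)) \<and>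
      (\<forall>v. summable (\<lambda>p. W.nrm (C.act.uact (f p) v))) \<and> (\<forall>v. fd_sums sW (\<lambda>p. C.act.uact (f p) v) (R z v)) \<and>
      W.operator (R z) \<and> (\<forall>v. R z (T' v) = v) \<and> (\<forall>v. T' (R z v) = v)"
    if z: "z \<in> carrier (G_circ cscale (cbr br) (cgr gr) ?\<Omega>C)" for z
  proof -
    obtain f T T' where f: "\<And>p. f p \<in> carrier free_alg" "\<And>p. z p = uea_class cscale (cbr br) (f p)"
      "\<And>v. summable (\<lambda>p. W.nrm (C.act.uact (f p) v))" "\<And>v. fd_sums sW (\<lambda>p. C.act.uact (f p) v) (T v)"
      "W.operator T" "\<And>v. T (T' v) = v" "\<And>v. T' (T v) = v"
      by (rule C.G_circ_rep[OF _ gr0C letterC z]) (simp, assumption, rule that)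
    have "R z = T" using R_rep[OF f(1,2,4)] by (rule ext)
    thus ?thesis using f by blast
  qed

  have "R \<in> hom (G_circ cscale (cbr br) (cgr gr) ?\<Omega>C) (GL sW)"
  proof (rule homI)
    fix z assume "z \<in> carrier (G_circ cscale (cbr br) (cgr gr) ?\<Omega>C)"
    then obtain T' where "W.operator (R z)" "\<forall>v. R z (T' v) = v" "\<forall>v. T' (R z v) = v" using G by blast
    moreover from this have "bij (R z)" by (intro o_bij[of T']) auto
    ultimately show "R z \<in> carrier (GL sW)" by (simp add: GL_def)
  next
    fix y z assume "y \<in> carrier (G_circ cscale (cbr br) (cgr gr) ?\<Omega>C)"
      "z \<in> carrier (G_circ cscale (cbr br) (cgr gr) ?\<Omega>C)"
    with G[of y] G[of z] obtain f g where
      f: "\<And>p. f p \<in> carrier free_alg" "\<And>p. y p = uea_class cscale (cbr br) (f p)"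
        "\<And>v. summable (\<lambda>p. W.nrm (C.act.uact (f p) v))" "\<And>v. fd_sums sW (\<lambda>p. C.act.uact (f p) v) (R y v)" and
      g: "\<And>p. g p \<in> carrier free_alg" "\<And>p. z p = uea_class cscale (cbr br) (g p)"
        "\<And>v. summable (\<lambda>p. W.nrm (C.act.uact (g p) v))" "\<And>v. fd_sums sW (\<lambda>p. C.act.uact (g p) v) (R z v)"
      by blast
    let ?fg = "\<lambda>p w. \<Sum>i\<le>p. conv (f i) (g (p - i)) w"
    have fg: "C.act.uact (?fg p) v = (\<Sum>i\<le>p. C.act.uact (f i) (C.act.uact (g (p - i)) v)) \<and>
        ?fg p \<in> carrier free_alg" for p v
      using C.act.uact_sum[of "{..p}" "\<lambda>i. conv (f i) (g (p - i))" v] f(1) g(1)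
      by (simp add: conv_closed C.act.uact_conv)
    have "R (y \<otimes>\<^bsub>useries cscale (cbr br) (cgr gr)\<^esub> z) v = R y (R z v)" for v
    proof (rule R_rep)
      show "fd_sums sW (\<lambda>p. C.act.uact (?fg p) v) (R y (R z v))"
        using W.fd_sums_Cauchy[OF C.operator_uact f(3,4) g(3,4)] fg by simp
      show "(y \<otimes>\<^bsub>useries cscale (cbr br) (cgr gr)\<^esub> z) p = uea_class cscale (cbr br) (?fg p)" for p
        by (rule useries_mult_rep[OF f(1) g(1) f(2) g(2)])
    qed (use fg in blast)
    thus "R (y \<otimes>\<^bsub>G_circ cscale (cbr br) (cgr gr) ?\<Omega>C\<^esub> z) = R y \<otimes>\<^bsub>GL sW\<^esub> R z"
      by (simp add: G_circ_def GL_def fun_eq_iff)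
  qed

  moreover have "integrates sW br gr ?\<Omega>C \<rho> R"
    unfolding integrates_def free_eval_uact
  proof (intro conjI allI impI ballI)
    fix \<xi> v assume \<xi>: "(\<forall>k. \<xi> k \<in> cgr gr k) \<and> finite {k. \<xi> k \<noteq> 0}"
    hence "\<xi> 0 \<in> cgr gr 0" by blast
    hence \<xi>0: "\<xi> 0 = 0" using gr0C by simp
    obtain r where r: "fd_sums sW (\<lambda>p. C.act.exp_component \<xi> 1 p v) r"
      "fd_sums sW (\<lambda>m. sW (1 / fact m) ((?\<sigma> (\<Sum>k | \<xi> k \<noteq> 0. \<xi> k) ^^ m) v)) r"
      by (rule C.exp_finite_sums[where \<xi> = \<xi> and v = v, OF \<xi>0 conjunct2[OF \<xi>]])
    let ?E = "\<lambda>p. lin_comb {w. length w \<le> p \<and> sum_list w = p} (\<lambda>w. 1 / fact (length w)) (map \<xi>)"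
    have "R (useries_exp cscale (cbr br) (cgr gr) (lie_series cscale (cbr br) \<xi>)) v = r"
    proof (rule R_rep[of ?E])
      show "fd_sums sW (\<lambda>p. C.act.uact (?E p) v) r"
        using r(1) by (simp only: C.act.uact_exp_rep[where \<xi> = \<xi>, OF \<xi>0])
    qed (rule lin_comb_carrier[OF finite_words_sum_le], rule useries_exp_rep)
    thus "fd_sums sW (\<lambda>m. sW (1 / fact m) ((?\<sigma> (\<Sum>k | \<xi> k \<noteq> 0. \<xi> k) ^^ m) v))
        (R (useries_exp cscale (cbr br) (cgr gr) (lie_series cscale (cbr br) \<xi>)) v)"
      using r(2) by simp
  next
    fix z f v assume "z \<in> carrier (G_circ cscale (cbr br) (cgr gr) ?\<Omega>C)" and f: "\<forall>p. f p \<in> z p"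
    then obtain g where g: "\<And>p. g p \<in> carrier free_alg" "\<And>p. z p = uea_class cscale (cbr br) (g p)"
      "\<And>v. fd_sums sW (\<lambda>p. C.act.uact (g p) v) (R z v)" using G by blast
    have "C.act.uact (f p) v = C.act.uact (g p) v" for p
      using C.act.uact_class[OF g(1)] f g(2) by blast
    thus "fd_sums sW (\<lambda>p. C.act.uact (f p) v) (R z v)" using g(3) by simp
  qed

  moreover have "unitary_op sW h (R (series_complexify br z))"
    if h: "hermitian_inner sW h" "\<forall>j\<in>{1..n}. anti_selfadjoint h (\<rho> (\<omega> j))"
      and z: "z \<in> carrier (G_circ scaleR br gr ?\<Omega>)" for h z
  proof -
    obtain f T T' where f: "\<And>p. f p \<in> carrier free_alg" "\<And>p. z p = uea_class scaleR br (f p)"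
      "\<And>p w. f p w \<noteq> 0 \<Longrightarrow> set w \<subseteq> ?\<Omega>" "\<And>v. fd_sums sW (\<lambda>p. R.act.uact (f p) v) (T v)"
      "\<And>v. fd_sums sW (\<lambda>p. R.act.uact (antipode (f p)) v) (T' v)"
      "W.operator T" "\<And>v. T (T' v) = v" "\<And>v. T' (T v) = v"
      by (rule R.G_circ_rep[OF _ gr_zero letterR z]) (simp, assumption, rule that)
    have word: "foldr ?\<sigma> (map (\<lambda>x. (x, 0)) w) v = foldr \<rho> w v" for w v
      by (induction w) (simp_all add: complexify_rep_def \<rho>0)
    \<comment> \<open>The scalars of the two actions differ, but on \<open>W\<close> the real one
      acts through \<open>of_real\<close> and a letter \<open>(x, 0)\<close> acts as
      \<open>\<rho> x\<close>.\<close>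
    have evC: "C.act.uact (free_complexify g) v = R.act.uact g v" "free_complexify g \<in> carrier free_alg"
      if "g \<in> carrier free_alg" for g v
      using that unfolding free_complexify_lin_comb[OF that]
      by (simp_all add: C.act.uact_lin_comb R.act.uact_def free_alg_carrier word
          lin_comb_carrier[unfolded free_alg_carrier])
    have "R (series_complexify br z) = T"
    proof
      fix v
      have carr: "g \<in> carrier free_alg" if "g \<in> z p" for g p
        using that uea_class_memE[OF f(1)] f(2) by metis
      show "R (series_complexify br z) v = T v"
      \<comment> \<open>\<open>series_complexify\<close> is a union of classes. Instead of showing
        that these coincide, it suffices that all their elements act as \<open>f p\<close>
        does.\<close>
      proof (rule R_eqI[OF _ _ f(4)])
        fix p g assume "g \<in> series_complexify br z p"
        then obtain k where k: "k \<in> z p" "g \<in> uea_class cscale (cbr br) (free_complexify k)"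
          by (auto simp: series_complexify_def)
        show "C.act.uact g v = R.act.uact (f p) v"
          using C.act.uact_class[OF evC(2)[OF carr[OF k(1)]] k(2)] evC(1)[OF carr[OF k(1)]]
            R.act.uact_class[OF f(1)] k(1) f(2) by metis
      next
        fix p
        have "f p \<in> z p" using f uea_class_self by metis
        moreover have "free_complexify (f p) \<in> uea_class cscale (cbr br) (free_complexify (f p))"
          by (intro uea_class_self evC f)
        ultimately show "series_complexify br z p \<noteq> {}" by (auto simp: series_complexify_def)
      qed
    qed
    moreover have "h (T u) (T v) = h u v" for u v
    proof (rule hermitian_limit_unitary[OF W.fd_complex_axioms h(1) f(4,5) _ f(8)])
      fix p u v
      note hl = hermitian_innerD[OF h(1)]
      have hr: "h w (x + y) = h w x + h w y" "h w (sW c x) = cnj c * h w x" for x y w c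
        by (simp_all only: hl(3)[of w] hl(1,2) complex_cnj_add complex_cnj_mult)
      have h0: "h 0 w = 0" "h w 0 = 0" for w using hl(1)[of 0 0 w] hr(1)[of w 0 0] by auto
      have hsum: "h (\<Sum>i\<in>I. F i) w = (\<Sum>i\<in>I. h (F i) w)" "h w (\<Sum>i\<in>I. F i) = (\<Sum>i\<in>I. h w (F i))"
        for I w and F :: "'g list \<Rightarrow> 'w"
        by (induction I rule: infinite_finite_induct) (simp_all add: h0 hl(1) hr(1))
      \<comment> \<open>Moving letters across \<open>h\<close> one by one reverses the word and
        costs a sign each. Anti-selfadjointness is given on the generators, which is why
        \<open>f p\<close> was chosen with all its words in them.\<close>
      have adj: "h (foldr \<rho> w u) v = (- 1) ^ length w * h u (foldr \<rho> (rev w) v)" if "set w \<subseteq> ?\<Omega>" for w v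
        using that
      proof (induction w arbitrary: v)
        case (Cons x w)
        have "h (foldr \<rho> (x # w) u) v = - h (foldr \<rho> w u) (\<rho> x v)"
          using Cons.prems h(2) by (auto simp: anti_selfadjoint_def)
        thus ?case using Cons by simp
      qed simp
      \<comment> \<open>The coefficients are real, so the conjugation in the second argument of
        \<open>h\<close> leaves them unchanged.\<close>
      show "h (R.act.uact (f p) u) v = h u (R.act.uact (antipode (f p)) v)"
        unfolding R.act.uact_def[of "f p"] R.uact_antipode[OF f(1)] hsum hl(2) hr(2)
        by (intro sum.cong refl) (use f(3) adj in \<open>auto simp: mult_ac\<close>)
    qed
    moreover have "bij T" using f(7,8) by (intro o_bij[of T']) auto
    ultimately show ?thesis using f(6) by (simp add: unitary_op_def)
  qed
  ultimately show ?thesis by blast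
qed

end
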